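(* Let $n,d\ge 2$ be integers. Assume $\mathbb{F}$ is a finite field and $\mathbb{L}$ is a finite or infinite field with $\operatorname{char}\mathbb{F}=\operatorname{char}\mathbb{L}=p$ and $\#\mathbb{F}<\#\mathbb{L}$. 1. Let $\#\mathbb{F}<n$ and $\#\mathbb{L}<n$. If $l\mid t$, where $\#\mathbb{F}=p^l$ and $\#\mathbb{L}=p^t$, then $C_{n,d}^{\mathbb{F}}\ge C_{n,d}^{\mathbb{L}}$. 2. If $\#\mathbb{F}<n\le \#\mathbb{L}$, then $C_{n,d}^{\mathbb{F}}\ge C_{n,d}^{\mathbb{L}}$. 3. If $\#\mathbb{F}\ge n$ and $\#\mathbb{L}\ge n$, then $C_{n,d}^{\mathbb{F}}=C_{n,d}^{\mathbb{L}}$.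
   Context: $\langle X\rangle_d$ is the free semigroup (without unity) on letters $x_1,\dots,x_d$; for a field $\mathbb{K}$, $\mathbb{K}\langle X\rangle_d$ is the semigroup algebra, i.e. the free associative non-unital $\mathbb{K}$-algebra on $x_1,\dots,x_d$. Define $N_{n,d}^{\mathbb{K}}=\mathbb{K}\langle X\rangle_d/\mathrm{id}\{x^n\mid x\in\mathbb{K}\langle X\rangle_d\}$, the quotient by the two-sided ideal generated by all $n$-th powers of elements. It is a nilpotent algebra, and $C_{n,d}^{\mathbb{K}}=\min\{c>0\mid a_1\cdots a_c=0\text{ for all }a_1,\dots,a_c\in N_{n,d}^{\mathbb{K}}\}$ is its nilpotency degree. $\#\mathbb{K}$ denotes the cardinality of $\mathbb{K}$. *)

theory Defs
  imports "HOL-Library.Poly_Mapping" "HOL-Library.Equipollence" "HOL-Library.Cardinality"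
    "HOL-Computational_Algebra.Computational_Algebra"
begin

text \<open>
  Words in the letters \<open>0, 1, 2, \<dots>\<close> form a monoid under concatenation. It is written additively
  (although it is not commutative) because the library sets up convolution of finitely supported functions,
  i.e. the multiplication of the monoid algebra \<open>word \<Rightarrow>\<^sub>0 'k\<close>, for additive monoids.
\<close>

datatype word = Word (letters: "nat list")

instantiation word :: monoid_add
begin

definition zero_word :: word where
  "0 = Word []"

definition plus_word :: "word \<Rightarrow> word \<Rightarrow> word" where
  "u + v = Word (letters u @ letters v)"

instance
  by standard (simp_all add: zero_word_def plus_word_def)

end

definition free_semigroup :: "nat \<Rightarrow> word set" where
  "free_semigroup d = {w. letters w \<noteq> [] \<and> set (letters w) \<subseteq> {..<d}}"

text \<open>
  The free non-unital algebra on \<open>d\<close> letters, as a subset of the unital algebra \<open>word \<Rightarrow>\<^sub>0 'k\<close>.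
\<close>

definition free_algebra :: "nat \<Rightarrow> (word \<Rightarrow>\<^sub>0 'k::field) set" where
  "free_algebra d = {f. Poly_Mapping.keys f \<subseteq> free_semigroup d}"

text \<open>
  Two-sided ideals of a non-unital algebra \<open>A\<close> over the field \<open>'k\<close>. Closure under scalars has to be
  required separately; the product with \<open>single 0 c\<close> is multiplication by the scalar \<open>c\<close>.
\<close>

definition algebra_ideal :: "(word \<Rightarrow>\<^sub>0 'k::field) set \<Rightarrow> (word \<Rightarrow>\<^sub>0 'k) set \<Rightarrow> bool" where
  "algebra_ideal A I \<longleftrightarrow>
     I \<subseteq> A \<and> 0 \<in> I \<and>
     (\<forall>x\<in>I. \<forall>y\<in>I. x + y \<in> I) \<and>
     (\<forall>c. \<forall>x\<in>I. Poly_Mapping.single 0 c * x \<in> I) \<and>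
     (\<forall>a\<in>A. \<forall>x\<in>I. a * x \<in> I \<and> x * a \<in> I)"

definition generated_ideal :: "(word \<Rightarrow>\<^sub>0 'k::field) set \<Rightarrow> (word \<Rightarrow>\<^sub>0 'k) set \<Rightarrow> (word \<Rightarrow>\<^sub>0 'k) set" where
  "generated_ideal A S = \<Inter> {I. algebra_ideal A I \<and> S \<subseteq> I}"

definition power_ideal :: "nat \<Rightarrow> nat \<Rightarrow> (word \<Rightarrow>\<^sub>0 'k::field) set" where
  "power_ideal n d = generated_ideal (free_algebra d) {x ^ n | x. x \<in> free_algebra d}"

text \<open>The quotient algebra \<open>N\<^bsub>n,d\<^esub>\<close>, with cosets as elements.\<close>

definition power_rel :: "nat \<Rightarrow> nat \<Rightarrow> ((word \<Rightarrow>\<^sub>0 'k::field) \<times> (word \<Rightarrow>\<^sub>0 'k)) set" where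
  "power_rel n d = {(x, y). x \<in> free_algebra d \<and> y \<in> free_algebra d \<and> x - y \<in> power_ideal n d}"

definition N_carrier :: "nat \<Rightarrow> nat \<Rightarrow> (word \<Rightarrow>\<^sub>0 'k::field) set set" where
  "N_carrier n d = free_algebra d // power_rel n d"

definition N_zero :: "nat \<Rightarrow> nat \<Rightarrow> (word \<Rightarrow>\<^sub>0 'k::field) set" where
  "N_zero n d = power_rel n d `` {0}"

definition N_mult :: "nat \<Rightarrow> nat \<Rightarrow> (word \<Rightarrow>\<^sub>0 'k::field) set \<Rightarrow> (word \<Rightarrow>\<^sub>0 'k) set \<Rightarrow> (word \<Rightarrow>\<^sub>0 'k) set" where
  "N_mult n d X Y = (\<Union>x\<in>X. \<Union>y\<in>Y. power_rel n d `` {x * y})"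

text \<open>
  The product \<open>a\<^sub>1 \<cdots> a\<^sub>c\<close> is only meant for nonempty lists, as \<open>N\<^bsub>n,d\<^esub>\<close> has no unit.
\<close>

definition N_prod :: "nat \<Rightarrow> nat \<Rightarrow> (word \<Rightarrow>\<^sub>0 'k::field) set list \<Rightarrow> (word \<Rightarrow>\<^sub>0 'k) set" where
  "N_prod n d as = foldl (N_mult n d) (hd as) (tl as)"

definition nilpotency_degree :: "'k::field itself \<Rightarrow> nat \<Rightarrow> nat \<Rightarrow> nat" where
  "nilpotency_degree _ n d =
     (LEAST c. c > 0 \<and>
        (\<forall>as. length as = c \<and> set as \<subseteq> (N_carrier n d :: (word \<Rightarrow>\<^sub>0 'k) set set)
              \<longrightarrow> N_prod n d as = N_zero n d))"

text \<open>Multiplication of cosets is multiplication of representatives.\<close>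

lemma free_algebra_closed:
  fixes x y :: "word \<Rightarrow>\<^sub>0 'k::field"
  shows "0 \<in> (free_algebra d :: (word \<Rightarrow>\<^sub>0 'k) set)"
    and "x \<in> free_algebra d \<Longrightarrow> y \<in> free_algebra d \<Longrightarrow> x + y \<in> free_algebra d"
    and "x \<in> free_algebra d \<Longrightarrow> Poly_Mapping.single 0 c * x \<in> free_algebra d"
    and "x \<in> free_algebra d \<Longrightarrow> y \<in> free_algebra d \<Longrightarrow> x * y \<in> free_algebra d"
proof -
  show "0 \<in> (free_algebra d :: (word \<Rightarrow>\<^sub>0 'k) set)"
    by (simp add: free_algebra_def)
  show "x + y \<in> free_algebra d" if "x \<in> free_algebra d" "y \<in> free_algebra d"
    using that Poly_Mapping.keys_add[of x y] by (auto simp: free_algebra_def)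
  show "Poly_Mapping.single 0 c * x \<in> free_algebra d" if "x \<in> free_algebra d"
    using that keys_mult[of "Poly_Mapping.single 0 c" x]
    by (fastforce simp: free_algebra_def split: if_splits)
  show "x * y \<in> free_algebra d" if "x \<in> free_algebra d" "y \<in> free_algebra d"
    using that keys_mult[of x y]
    by (fastforce simp: free_algebra_def free_semigroup_def plus_word_def)
qed

lemma power_in_free_algebra:
  fixes x :: "word \<Rightarrow>\<^sub>0 'k::field"
  assumes "x \<in> free_algebra d" "n > 0"
  shows "x ^ n \<in> free_algebra d"
  using assms(2)
proof (induction n rule: nat_induct_non_zero)
  case (Suc n)
  then show ?case using assms(1) by (simp add: free_algebra_closed)
qed (use assms(1) in simp)

lemma algebra_ideal_power_ideal:
  assumes "n > 0"
  shows "algebra_ideal (free_algebra d) (power_ideal n d :: (word \<Rightarrow>\<^sub>0 'k::field) set)"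
proof -
  let ?A = "free_algebra d :: (word \<Rightarrow>\<^sub>0 'k) set"
  have "algebra_ideal ?A ?A" "{x ^ n | x. x \<in> ?A} \<subseteq> ?A"
    using assms by (auto simp: algebra_ideal_def free_algebra_closed power_in_free_algebra)
  then have "power_ideal n d \<subseteq> ?A"
    unfolding power_ideal_def generated_ideal_def by blast
  then show ?thesis
    unfolding algebra_ideal_def power_ideal_def generated_ideal_def by blast
qed

lemma power_ideal_diff:
  fixes x y :: "word \<Rightarrow>\<^sub>0 'k::field"
  assumes "n > 0" "x \<in> power_ideal n d" "y \<in> power_ideal n d"
  shows "x - y \<in> power_ideal n d"
proof -
  have "Poly_Mapping.single 0 (-1) * y \<in> power_ideal n d"
    using algebra_ideal_power_ideal[OF assms(1)] assms(3) by (metis algebra_ideal_def)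
  moreover have "Poly_Mapping.single 0 (-1) * y = - y"
    by (simp add: single_uminus)
  ultimately have "x + - y \<in> power_ideal n d"
    using algebra_ideal_power_ideal[OF assms(1)] assms(2) by (metis algebra_ideal_def)
  then show ?thesis by simp
qed

lemma equiv_power_rel:
  assumes "n > 0"
  shows "equiv (free_algebra d) (power_rel n d :: ((word \<Rightarrow>\<^sub>0 'k::field) \<times> _) set)"
proof (rule equivI)
  have 0: "0 \<in> (power_ideal n d :: (word \<Rightarrow>\<^sub>0 'k) set)"
    using algebra_ideal_power_ideal[OF assms] by (metis algebra_ideal_def)
  show "power_rel n d \<subseteq> free_algebra d \<times> (free_algebra d :: (word \<Rightarrow>\<^sub>0 'k) set)"
    by (auto simp: power_rel_def)
  show "refl_on (free_algebra d) (power_rel n d :: ((word \<Rightarrow>\<^sub>0 'k) \<times> _) set)"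
    using 0 by (auto simp: refl_on_def power_rel_def)
  show "sym (power_rel n d :: ((word \<Rightarrow>\<^sub>0 'k) \<times> _) set)"
    using power_ideal_diff[OF assms 0] by (fastforce simp: sym_def power_rel_def)
  show "trans (power_rel n d :: ((word \<Rightarrow>\<^sub>0 'k) \<times> _) set)"
  proof (rule transI)
    fix x y z :: "word \<Rightarrow>\<^sub>0 'k"
    assume *: "(x, y) \<in> power_rel n d" "(y, z) \<in> power_rel n d"
    then have "(x - y) + (y - z) \<in> power_ideal n d"
      using algebra_ideal_power_ideal[OF assms]
      unfolding power_rel_def algebra_ideal_def by blast
    with * show "(x, z) \<in> power_rel n d" by (auto simp: power_rel_def)
  qed
qed

lemma N_mult_class:
  fixes x y :: "word \<Rightarrow>\<^sub>0 'k::field"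
  assumes "n > 0" "x \<in> free_algebra d" "y \<in> free_algebra d"
  shows "N_mult n d (power_rel n d `` {x}) (power_rel n d `` {y}) = power_rel n d `` {x * y}"
proof -
  note eq = equiv_power_rel[OF assms(1), of d, where ?'k = 'k]
  have "power_rel n d `` {x' * y'} = power_rel n d `` {x * y}"
    if *: "(x, x') \<in> power_rel n d" "(y, y') \<in> power_rel n d" for x' y' :: "word \<Rightarrow>\<^sub>0 'k"
  proof -
    have "(x - x') * y \<in> power_ideal n d" "x' * (y - y') \<in> power_ideal n d"
      using algebra_ideal_power_ideal[OF assms(1)] *
      unfolding power_rel_def algebra_ideal_def by blast+
    then have "(x - x') * y + x' * (y - y') \<in> power_ideal n d"
      using algebra_ideal_power_ideal[OF assms(1)] unfolding algebra_ideal_def by blast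
    then have "x * y - x' * y' \<in> power_ideal n d"
      by (simp add: algebra_simps)
    then have "(x * y, x' * y') \<in> power_rel n d"
      using * by (auto simp: power_rel_def free_algebra_closed)
    from equiv_class_eq[OF eq this] show ?thesis by simp
  qed
  moreover have "x \<in> power_rel n d `` {x}" "y \<in> power_rel n d `` {y}"
    using equiv_class_self[OF eq] assms by auto
  ultimately show ?thesis unfolding N_mult_def by blast
qed

end

theory Submission
  imports Defs "HOL-Library.Sublist"
begin

text \<open>
  Expanding \<open>(\<Sum>w\<in>W. t w \<cdot> w) ^ n\<close> and collecting the sequences of words with the same monomial
  \<^emph>\<open>function\<close> of the coefficients \<open>t\<close> writes it as \<open>\<Sum>\<chi>. \<chi>(t) \<cdot> S\<^sub>\<chi>\<close>, where the \<open>\<chi>\<close> are distinct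
  characters of a monoid and each \<open>S\<^sub>\<chi>\<close> has coefficients in the prime field. By independence of
  characters the ideal of \<open>n\<close>-th powers is the span of the elements \<open>u S\<^sub>\<chi> v\<close>. Whether a word lies in
  this span is a linear system over the prime field, so it does not depend on the field of scalars but only on the
  partition of the sequences into characters. In each of the three cases the partition over \<open>L\<close> refines
  the one over \<open>F\<close>: either \<open>s ^ #L = s\<close> holds on \<open>F\<close>, or \<open>L\<close> is so large that monomials of degree \<open>n\<close>
  coincide as functions only if they are equal. That some nilpotency degree exists, so that the minimum is
  meaningful, follows from Shirshov's theorem on words, applied to the multilinear identity
  \<open>\<Sum>\<sigma>. x\<^bsub>\<sigma> 1\<^esub> \<cdots> x\<^bsub>\<sigma> n\<^esub> = 0\<close>.
\<close>

subsection \<open>Words without powers\<close>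

lemma take_eq_concat_replicate:
  assumes "take m ys = take m (drop q ys)" and "k * q \<le> m + q"
  shows "take (k * q) ys = concat (replicate k (take q ys))"
  using assms(2)
proof (induction k)
  case (Suc k)
  then have "k * q \<le> m" by simp
  then have "take (k * q) (drop q ys) = take (k * q) ys"
    using assms(1) by (metis min.absorb1 take_take)
  moreover have "take (q + k * q) ys = take q ys @ take (k * q) (drop q ys)"
    by (simp add: take_add)
  ultimately show ?case using Suc by simp
qed simp

text \<open>Among the \<open>n\<close> windows of length \<open>n * n\<close> that start at
  positions below \<open>n\<close>, two coincide by pigeonhole. Their distance \<open>q < n\<close>
  is then a period over \<open>n * n + q\<close> letters, which leaves room for \<open>n\<close>
  copies of a block of length \<open>q\<close>.\<close>

lemma ex_power_sublist:
  fixes w :: "'a list"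
  assumes "n + n * n \<le> length w" and "finite S" and "card S < n"
    and S: "\<And>u. sublist u w \<Longrightarrow> length u = n * n \<Longrightarrow> u \<in> S"
  shows "\<exists>u. u \<noteq> [] \<and> sublist (concat (replicate n u)) w"
proof -
  define f where "f i = take (n * n) (drop i w)" for i
  have "f i \<in> S" if "i < n" for i
    unfolding f_def
    by (rule S) (use that assms(1) in \<open>auto intro: sublist_order.order_trans[OF sublist_take sublist_drop]\<close>)
  then have "card (f ` {..<n}) < card {..<n}"
    using assms(2,3) card_mono[of S "f ` {..<n}"] by (auto simp: image_subset_iff)
  then have "\<not> inj_on f {..<n}" using pigeonhole by blast
  then obtain i j where ij: "i < j" "j < n" "f i = f j"
    unfolding inj_on_def by (metis lessThan_iff nat_neq_iff)
  define q where "q = j - i"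
  define ys where "ys = drop i w"
  have "take (n * n) ys = take (n * n) (drop q ys)"
    using ij by (simp add: ys_def q_def f_def)
  moreover have "n * q \<le> n * n + q"
    using ij by (intro trans_le_add1 mult_le_mono) (auto simp: q_def)
  ultimately have "take (n * q) ys = concat (replicate n (take q ys))"
    by (rule take_eq_concat_replicate)
  moreover have "sublist (take (n * q) ys) w"
    unfolding ys_def by (rule sublist_order.order_trans[OF sublist_take sublist_drop])
  moreover have "take q ys \<noteq> []"
    using ij assms(1) by (auto simp: ys_def q_def)
  ultimately show ?thesis by metis
qed

text \<open>The lexicographically least word is split off and placed last; on words of equal length
  the order is total.\<close>

lemma ex_decreasing_list:
  fixes S :: "nat list set"
  assumes "finite S" and "n \<le> card S" and "\<And>u. u \<in> S \<Longrightarrow> length u = m"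
  shows "\<exists>vs. length vs = n \<and> set vs \<subseteq> S \<and> sorted_wrt (\<lambda>x y. (y, x) \<in> lex less_than) vs"
  using assms
proof (induction n arbitrary: S)
  case (Suc n)
  from Suc.prems have "S \<noteq> {}" by auto
  then obtain u where u: "u \<in> S" "\<And>v. (v, u) \<in> lex less_than \<Longrightarrow> v \<notin> S"
    by (metis all_not_in_conv wfE_min wf_lex wf_less_than)
  have "\<exists>vs. length vs = n \<and> set vs \<subseteq> S - {u} \<and> sorted_wrt (\<lambda>x y. (y, x) \<in> lex less_than) vs"
    using Suc.prems u by (intro Suc.IH) auto
  then obtain vs where vs: "length vs = n" "set vs \<subseteq> S - {u}"
    "sorted_wrt (\<lambda>x y. (y, x) \<in> lex less_than) vs" by blast
  have "(u, v) \<in> lex less_than" if "v \<in> set vs" for v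
  proof -
    have v: "v \<in> S" "v \<noteq> u" using that vs by auto
    then have "length v = length u" using Suc.prems u by simp
    then show ?thesis
      using total_lenlex[OF total_less_than] u(2)[of v] v
      unfolding total_on_def lenlex_conv by (metis (mono_tags, lifting) UNIV_I case_prodD less_irrefl mem_Collect_eq)
  qed
  then show ?case
    using vs u by (intro exI[of _ "vs @ [u]"]) (auto simp: sorted_wrt_append)
qed simp

text \<open>The factors may differ in length, so only their prefixes of a common length
  \<open>m\<close> are compared. A difference between such prefixes decides the comparison of whole
  concatenations, whatever follows.\<close>

definition lex_decreasing :: "nat list list \<Rightarrow> bool" where
  "lex_decreasing us \<longleftrightarrow> (\<exists>m>0. (\<forall>u\<in>set us. m \<le> length u) \<and>
     sorted_wrt (\<lambda>x y. (take m y, take m x) \<in> lex less_than) us)"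

lemma lex_decreasing_distinct: "lex_decreasing us \<Longrightarrow> distinct us"
  unfolding lex_decreasing_def
  by (induction us) (auto simp: irrefl_less_than)

text \<open>At the first position where the sequences differ, the word of \<open>ws\<close> occurs
  later in \<open>us\<close>, so its prefix is smaller than that of the word of \<open>us\<close>.
  The decreasing order thus gives the strictly largest of all rearranged products.\<close>

lemma concat_less_concat_lex_decreasing:
  assumes "lex_decreasing us" and "mset ws = mset us" and "ws \<noteq> us"
  shows "(concat ws, concat us) \<in> lex less_than"
  using assms
proof (induction us arbitrary: ws)
  case (Cons u us)
  obtain m where m: "0 < m" "\<forall>v\<in>set (u # us). m \<le> length v"
    "sorted_wrt (\<lambda>x y. (take m y, take m x) \<in> lex less_than) (u # us)"
    using Cons.prems(1) unfolding lex_decreasing_def by blast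
  obtain x xs where ws: "ws = x # xs" using Cons.prems(2) by (cases ws) auto
  \<comment> \<open>\<open>lex\<close> relates only lists of equal length.\<close>
  have len: "length (concat ws) = length (concat (u # us))"
    using Cons.prems(2) unfolding length_concat
    by (metis mset_map sum_mset_sum_list)
  show ?case
  proof (cases "x = u")
    case True
    have "lex_decreasing us" using m unfolding lex_decreasing_def by auto
    then have "(concat xs, concat us) \<in> lex less_than"
      using Cons.prems ws True by (intro Cons.IH) auto
    then show ?thesis using ws True by (simp add: lex_append_leftI)
  next
    case False
    have "x \<in> set (u # us)" using Cons.prems(2) ws by (metis list.set_intros(1) mset_eq_setD)
    then have x: "m \<le> length x" "(take m x, take m u) \<in> lex less_than"
      using m False by auto
    have "(take m x @ (drop m x @ concat xs), take m u @ (drop m u @ concat us)) \<in> lex less_than"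
    proof (rule lex_append_rightI[OF x(2)])
      show "length (drop m u @ concat us) = length (drop m x @ concat xs)"
        using len ws m(2) x(1) by auto
    qed
    then show ?thesis using ws by (metis append.assoc append_take_drop_id concat.simps(2))
  qed
qed simp

text \<open>Each word of \<open>vs\<close> is found in its own block of \<open>b\<close> letters,
  and the letters up to the next occurrence are attached to it as a tail.\<close>

lemma ex_prefix_factorization:
  assumes "\<And>w v. w \<in> L \<Longrightarrow> sublist v w \<Longrightarrow> v \<in> L"
    and "\<And>w v. w \<in> L \<Longrightarrow> b \<le> length w \<Longrightarrow> v \<in> set vs \<Longrightarrow> sublist v w"
    and "w \<in> L" and "length vs * b \<le> length w"
  shows "\<exists>a us. w = a @ concat us \<and> list_all2 prefix vs us"
  using assms(2-)
proof (induction vs arbitrary: w)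
  case (Cons v vs)
  have "sublist v (take b w)"
    using Cons.prems by (intro Cons.prems(1) assms(1)[OF _ sublist_take]) auto
  then obtain a c where ac: "take b w = a @ v @ c" by (auto simp: sublist_def)
  have "\<exists>a us. drop b w = a @ concat us \<and> list_all2 prefix vs us"
  proof (rule Cons.IH)
    show "drop b w \<in> L" using Cons.prems by (intro assms(1)[OF _ sublist_drop])
  qed (use Cons.prems in auto)
  then obtain a' us where us: "drop b w = a' @ concat us" "list_all2 prefix vs us" by blast
  have "w = a @ concat ((v @ c @ a') # us)"
    using ac us by (metis append.assoc append_take_drop_id concat.simps(2))
  moreover have "list_all2 prefix (v # vs) ((v @ c @ a') # us)"
    using us by (simp add: prefix_def)
  ultimately show ?case by blast
qed (auto intro!: exI[of _ "[]"])

lemma lex_decreasing_if_prefixes: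
  assumes "list_all2 prefix vs us" and "\<And>v. v \<in> set vs \<Longrightarrow> length v = m"
    and "sorted_wrt (\<lambda>x y. (y, x) \<in> lex less_than) vs" and "0 < m"
  shows "lex_decreasing us"
proof -
  have "take m u = v \<and> m \<le> length u" if "prefix v u" "v \<in> set vs" for u v
    using that assms(2)[OF that(2)] by (auto simp: prefix_def)
  then have "list_all2 (\<lambda>v u. v = take m u \<and> m \<le> length u) vs us"
    by (intro list.rel_mono_strong[OF assms(1)]) blast
  then have take: "map (take m) us = vs" "\<forall>u\<in>set us. m \<le> length u"
    by (induction vs us rule: list_all2_induct) simp_all
  have "sorted_wrt (\<lambda>x y. (take m y, take m x) \<in> lex less_than) us"
    using assms(3) unfolding take(1)[symmetric] sorted_wrt_map .
  then show ?thesis using take(2) assms(4) unfolding lex_decreasing_def by blast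
qed

text \<open>
  Shirshov's theorem. After passing to sublanguages, every word of length \<open>n * n\<close> may be assumed to
  occur in all long words. If there are at least \<open>n\<close> of these words, they occur in decreasing order
  in a long word; otherwise some of them overlap themselves, which forces an \<open>n\<close>-th power.
\<close>

lemma bounded_language_if_no_powers_no_decreasing:
  fixes L :: "nat list set"
  assumes "finite A" and "0 < n" and "\<And>w. w \<in> L \<Longrightarrow> set w \<subseteq> A"
    and "\<And>w v. w \<in> L \<Longrightarrow> sublist v w \<Longrightarrow> v \<in> L"
    and "\<And>u. u \<noteq> [] \<Longrightarrow> concat (replicate n u) \<notin> L"
    and "\<And>us. length us = n \<Longrightarrow> lex_decreasing us \<Longrightarrow> concat us \<notin> L"
  shows "\<exists>b. \<forall>w\<in>L. length w < b"
  using assms(3-)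
proof (induction L rule: measure_induct_rule[of "\<lambda>L. card {w \<in> L. length w = n * n}"])
  case (less L)
  define S where "S = {w \<in> L. length w = n * n}"
  have "S \<subseteq> {w. set w \<subseteq> A \<and> length w = n * n}" using less.prems(1) by (auto simp: S_def)
  then have fin: "finite S" using finite_lists_length_eq[OF assms(1)] finite_subset by blast
  \<comment> \<open>Forbidding \<open>v\<close> removes \<open>v\<close> itself from the words of
    length \<open>n * n\<close>, so the measure drops. Hence every sufficiently long word of
    \<open>L\<close> contains \<open>v\<close>.\<close>
  have "\<exists>b. \<forall>w\<in>{w \<in> L. \<not> sublist v w}. length w < b" if "v \<in> S" for v
  proof (rule less.IH)
    have "{w \<in> {w \<in> L. \<not> sublist v w}. length w = n * n} \<subset> S"
      using that by (auto simp: S_def)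
    then show "card {w \<in> {w \<in> L. \<not> sublist v w}. length w = n * n} < card {w \<in> L. length w = n * n}"
      using fin psubset_card_mono S_def by metis
    show "u \<in> {w \<in> L. \<not> sublist v w}" if "w \<in> {w \<in> L. \<not> sublist v w}" "sublist u w" for u w
      using that less.prems(2) sublist_order.order_trans by blast
  qed (use less.prems in auto)
  then obtain f where f: "\<And>v w. v \<in> S \<Longrightarrow> w \<in> L \<Longrightarrow> \<not> sublist v w \<Longrightarrow> length w < f v"
    by (metis (mono_tags, lifting) mem_Collect_eq)
  define b where "b = Max (insert 0 (f ` S))"
  have b: "sublist v w" if "v \<in> S" "w \<in> L" "b \<le> length w" for v w
  proof -
    have "f v \<le> b" unfolding b_def using fin that by (intro Max_ge) auto
    then show ?thesis using f that by (meson leD le_trans)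
  qed
  show ?case
  proof (rule ccontr)
    assume "\<not> ?thesis"
    \<comment> \<open>The summand \<open>n * b\<close> provides \<open>n\<close> blocks for the
      factorization, and \<open>n + n * n\<close> provides the overlapping windows.\<close>
    then obtain w where w: "w \<in> L" "n * b + (n + n * n) \<le> length w"
      by (meson not_le_imp_less)
    show False
    proof (cases "card S < n")
      case True
      have "\<exists>u. u \<noteq> [] \<and> sublist (concat (replicate n u)) w"
        by (rule ex_power_sublist[OF _ fin True]) (use w less.prems(2) in \<open>auto simp: S_def\<close>)
      then show False using less.prems(2,3) w(1) by blast
    next
      case False
      then obtain vs where vs: "length vs = n" "set vs \<subseteq> S"
        "sorted_wrt (\<lambda>x y. (y, x) \<in> lex less_than) vs"
        using ex_decreasing_list[OF fin, of n "n * n"] S_def by (metis (lifting) mem_Collect_eq not_less)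
      have "\<exists>a us. w = a @ concat us \<and> list_all2 prefix vs us"
      proof (rule ex_prefix_factorization[of L b])
        show "v \<in> L" if "w \<in> L" "sublist v w" for w v using less.prems(2) that .
        show "sublist v w" if "w \<in> L" "b \<le> length w" "v \<in> set vs" for w v
          using b that vs(2) by blast
      qed (use w vs(1) in simp_all)
      then obtain a us where us: "w = a @ concat us" "list_all2 prefix vs us" by blast
      have "length v = n * n" if "v \<in> set vs" for v using that vs(2) unfolding S_def by blast
      then have "lex_decreasing us" using lex_decreasing_if_prefixes[OF us(2) _ vs(3)] assms(2) by simp
      moreover have "length us = n" using us(2) vs(1) by (metis list_all2_lengthD)
      moreover have "sublist (concat us) w" unfolding us(1) by (metis append_Nil2 sublist_appendI)
      then have "concat us \<in> L" using less.prems(2) w(1) by blast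
      ultimately show False using less.prems(4) by blast
    qed
  qed
qed

subsection \<open>Linear algebra\<close>

text \<open>
  Gaussian elimination: whether an integer is usable as a pivot depends only on the characteristic,
  so the same elimination runs over both fields.
\<close>

lemma linear_system_solvable_transfer:
  fixes a :: "'j \<Rightarrow> 'i \<Rightarrow> int" and b :: "'i \<Rightarrow> int" and x :: "'j \<Rightarrow> 'f::field"
  assumes "finite J" and "CHAR('f) > 0" and "CHAR('l::field) = CHAR('f)"
    and "\<And>i. (\<Sum>j\<in>J. of_int (a j i) * x j) = of_int (b i)"
  shows "\<exists>y :: 'j \<Rightarrow> 'l. \<forall>i. (\<Sum>j\<in>J. of_int (a j i) * y j) = of_int (b i)"
proof -
  have zero_iff: "of_int k = (0::'l) \<longleftrightarrow> of_int k = (0::'f)" for k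
    by (simp add: of_int_eq_0_iff_char_dvd assms(3))
  show ?thesis
    using assms(1,4)
  proof (induction J arbitrary: a b rule: finite_induct)
    case empty
    then show ?case using zero_iff by simp
  next
    case (insert k J)
    show ?case
    proof (cases "\<forall>i. of_int (a k i) = (0::'f)")
      case True
      then obtain y :: "'j \<Rightarrow> 'l" where "\<forall>i. (\<Sum>j\<in>J. of_int (a j i) * y j) = of_int (b i)"
        using insert by fastforce
      moreover have "of_int (a k i) = (0::'l)" for i using True zero_iff by blast
      ultimately show ?thesis using insert.hyps by (intro exI[of _ y]) simp
    next
      case False
      then obtain i0 where i0: "of_int (a k i0) \<noteq> (0::'f)" by blast
      \<comment> \<open>An integer that is nonzero in \<open>'f\<close> is coprime to the common
        characteristic; its Bezout cofactor \<open>r\<close> is an inverse in both fields at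
        once.\<close>
      have "prime CHAR('f)" using assms(2) by (rule prime_CHAR_semidom)
      then have "coprime (a k i0) (int CHAR('f))"
        using i0 by (metis coprime_commute of_int_eq_0_iff_char_dvd prime_imp_coprime prime_nat_int_transfer)
      then obtain r q where rq: "r * a k i0 + q * int CHAR('f) = 1"
        using bezout_int by (metis coprime_iff_gcd_eq_1)
      have r: "of_int r * of_int (a k i0) = (1::'f)" "of_int r * of_int (a k i0) = (1::'l)"
        using arg_cong[OF rq, of "of_int :: int \<Rightarrow> 'f"] arg_cong[OF rq, of "of_int :: int \<Rightarrow> 'l"]
        using of_nat_CHAR[where ?'a = 'l] by (simp_all add: assms(3))
      \<comment> \<open>Subtracting multiples of equation \<open>i0\<close> eliminates the unknown
        \<open>k\<close>, and the new coefficients are again integers.\<close>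
      define a' where "a' j i = a j i - a k i * r * a j i0" for j i
      define b' where "b' i = b i - a k i * r * b i0" for i
      have elim: "(\<Sum>j\<in>J. of_int (a' j i) * z j) =
          (\<Sum>j\<in>J. of_int (a j i) * z j) - of_int (a k i) * of_int r * (\<Sum>j\<in>J. of_int (a j i0) * z j)"
        for i and z :: "'j \<Rightarrow> 'c::field"
        by (simp add: a'_def sum_subtractf algebra_simps sum_distrib_left)
      have eq: "(\<Sum>j\<in>J. of_int (a j i) * x j) = of_int (b i) - of_int (a k i) * x k" for i
        using insert.prems[of i] insert.hyps by (simp add: eq_diff_eq add.commute)
      have "(\<Sum>j\<in>J. of_int (a' j i) * x j) = of_int (b' i)" for i
      proof -
        have "(\<Sum>j\<in>J. of_int (a' j i) * x j) = of_int (b i) - of_int (a k i) * x k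
            - of_int (a k i) * (of_int r * of_int (b i0) - of_int r * of_int (a k i0) * x k)"
          unfolding elim eq by (simp add: algebra_simps)
        then show ?thesis unfolding r(1) by (simp add: b'_def algebra_simps)
      qed
      then have "\<exists>y :: 'j \<Rightarrow> 'l. \<forall>i. (\<Sum>j\<in>J. of_int (a' j i) * y j) = of_int (b' i)"
        by (rule insert.IH)
      then obtain y :: "'j \<Rightarrow> 'l"
        where y: "\<And>i. (\<Sum>j\<in>J. of_int (a' j i) * y j) = of_int (b' i)" by blast
      define z where "z = y(k := of_int r * (of_int (b i0) - (\<Sum>j\<in>J. of_int (a j i0) * y j)))"
      have "(\<Sum>j\<in>J. of_int (a j i) * z j) = (\<Sum>j\<in>J. of_int (a j i) * y j)" for i
        using insert.hyps by (intro sum.cong) (auto simp: z_def)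
      then have "(\<Sum>j\<in>insert k J. of_int (a j i) * z j) = of_int (b i)" for i
        using y[of i] insert.hyps unfolding elim
        by (simp add: z_def b'_def algebra_simps)
      then show ?thesis by blast
    qed
  qed
qed

text \<open>Artin's argument, with vectors modulo \<open>V\<close> in place of scalars: subtracting
  \<open>\<psi> s\<close> times the relation at \<open>t\<close> from the relation at
  \<open>m s t\<close> removes \<open>\<psi>\<close> and multiplies the vector of
  \<open>\<chi>\<close> by \<open>\<chi> s - \<psi> s\<close>. For a given \<open>\<chi>\<close>
  some \<open>s\<close> makes this factor nonzero.\<close>

lemma (in vector_space) characters_independent:
  fixes X :: "('t \<Rightarrow> 'a) set" and v :: "('t \<Rightarrow> 'a) \<Rightarrow> 'b" and m :: "'t \<Rightarrow> 't \<Rightarrow> 't"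
  assumes "subspace V" and "finite X"
    and one: "\<And>\<chi>. \<chi> \<in> X \<Longrightarrow> \<chi> e = 1"
    and mult: "\<And>\<chi> s t. \<chi> \<in> X \<Longrightarrow> \<chi> (m s t) = \<chi> s * \<chi> t"
    and V: "\<And>t. (\<Sum>\<chi>\<in>X. \<chi> t *s v \<chi>) \<in> V"
    and "\<chi> \<in> X"
  shows "v \<chi> \<in> V"
  using assms(2-)
proof (induction X arbitrary: v \<chi> rule: finite_induct)
  case (insert \<psi> X)
  have V': "v \<phi> \<in> V" if "\<phi> \<in> X" for \<phi>
  proof -
    have "\<phi> \<noteq> \<psi>" using that insert.hyps by blast
    then obtain s where s: "\<phi> s \<noteq> \<psi> s" by blast
    define v' where "v' \<chi> = (\<chi> s - \<psi> s) *s v \<chi>" for \<chi>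
    have "(\<Sum>\<chi>\<in>X. \<chi> t *s v' \<chi>) \<in> V" for t
    proof -
      have "(\<Sum>\<chi>\<in>X. \<chi> t *s v' \<chi>) = (\<Sum>\<chi>\<in>insert \<psi> X. \<chi> t *s v' \<chi>)"
        using insert.hyps by (simp add: v'_def)
      also have "\<dots> = (\<Sum>\<chi>\<in>insert \<psi> X. \<chi> (m s t) *s v \<chi> - \<psi> s *s (\<chi> t *s v \<chi>))"
        by (intro sum.cong refl) (simp only: v'_def insert.prems(2) scale_scale
            scale_left_diff_distrib[symmetric] right_diff_distrib, simp add: mult.commute)
      also have "\<dots> = (\<Sum>\<chi>\<in>insert \<psi> X. \<chi> (m s t) *s v \<chi>) - \<psi> s *s (\<Sum>\<chi>\<in>insert \<psi> X. \<chi> t *s v \<chi>)"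
        by (simp only: sum_subtractf scale_sum_right)
      also have "\<dots> \<in> V"
        by (intro subspace_diff[OF assms(1)] subspace_scale[OF assms(1)] insert.prems(3))
      finally show ?thesis .
    qed
    then have "v' \<phi> \<in> V" by (rule insert.IH[rotated 2]) (use insert.prems(1,2) that in simp_all)
    then have "inverse (\<phi> s - \<psi> s) *s v' \<phi> \<in> V" by (rule subspace_scale[OF assms(1)])
    then show ?thesis using s by (simp add: v'_def)
  qed
  \<comment> \<open>At \<open>e\<close> all characters are 1, so the vector of \<open>\<psi>\<close>
    remains when vectors known to lie in \<open>V\<close> are removed from a sum in
    \<open>V\<close>.\<close>
  have "(\<Sum>\<chi>\<in>insert \<psi> X. v \<chi>) = (\<Sum>\<chi>\<in>insert \<psi> X. \<chi> e *s v \<chi>)"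
    by (intro sum.cong refl) (simp only: insert.prems(1) scale_one)
  then have "(\<Sum>\<chi>\<in>insert \<psi> X. v \<chi>) \<in> V"
    using insert.prems(3)[of e] by (simp only:)
  then have "(\<Sum>\<chi>\<in>insert \<psi> X. v \<chi>) - (\<Sum>\<chi>\<in>X. v \<chi>) \<in> V"
    by (rule subspace_diff[OF assms(1) _ subspace_sum[OF assms(1) V']])
  then have "v \<psi> \<in> V" using insert.hyps by simp
  with V' insert.prems(4) show ?case by blast
qed simp

section \<open>The monoid algebra of words as a vector space\<close>

lemma poly_mapping_sum_single:
  "(\<Sum>w\<in>Poly_Mapping.keys x. Poly_Mapping.single w (Poly_Mapping.lookup x w)) = x"
  by (rule poly_mapping_eqI)
    (auto simp: lookup_sum lookup_single when_def in_keys_iff sum.delta)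

lemma single_zero_commute:
  fixes x :: "'a::monoid_add \<Rightarrow>\<^sub>0 'k::comm_ring_1"
  shows "x * Poly_Mapping.single 0 c = Poly_Mapping.single 0 c * x"
  by (subst (1 2) poly_mapping_sum_single[of x, symmetric])
    (simp add: sum_distrib_left sum_distrib_right mult_single mult.commute)

interpretation word_algebra: vector_space
  "\<lambda>(c::'k::field) (x::word \<Rightarrow>\<^sub>0 'k). Poly_Mapping.single 0 c * x"
  by unfold_locales
    (simp_all add: distrib_left distrib_right single_add mult_single mult.assoc[symmetric])

subsection \<open>The ideal of powers\<close>

text \<open>Mostly used without the argument \<open>t\<close>: over a small field, different
  multisets of words can give the same function of the coefficients.\<close>

definition monomial :: "'a list \<Rightarrow> ('a \<Rightarrow> 'k::comm_monoid_mult) \<Rightarrow> 'k" where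
  "monomial ws t = prod_list (map t ws)"

lemma monomial_one: "monomial ws (\<lambda>_. 1) = 1"
  by (induction ws) (simp_all add: monomial_def)

lemma monomial_mult: "monomial ws (\<lambda>w. s w * t w) = monomial ws s * monomial ws t"
  by (induction ws) (simp_all add: monomial_def ac_simps)

lemma monomial_eq_if_mset_eq: "mset ws = mset ws' \<Longrightarrow> monomial ws = monomial ws'"
  unfolding monomial_def fun_eq_iff by (metis mset_map prod_mset_prod_list)

lemma monomial_eq_prod_count:
  assumes "finite A" and "set ws \<subseteq> A"
  shows "monomial ws t = (\<Prod>a\<in>A. t a ^ count_list ws a)"
  using assms(2)
proof (induction ws)
  case (Cons w ws)
  have "(\<Prod>a\<in>A. t a ^ count_list (w # ws) a) = (\<Prod>a\<in>A. (if a = w then t a else 1) * t a ^ count_list ws a)"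
    by (intro prod.cong) auto
  also have "\<dots> = t w * (\<Prod>a\<in>A. t a ^ count_list ws a)"
    using Cons.prems assms(1) by (simp add: prod.distrib prod.delta)
  finally show ?case using Cons by (simp add: monomial_def)
qed (simp add: monomial_def)

lemma monomial_single: "monomial ws (\<lambda>v. if v = w then s else 1) = s ^ count_list ws w"
  by (induction ws) (simp_all add: monomial_def)

text \<open>Coefficients that are 1 except at one word isolate the exponent of that word.\<close>

lemma monomial_eq_iff:
  "(monomial ws :: ('a \<Rightarrow> 'k::comm_monoid_mult) \<Rightarrow> 'k) = monomial ws' \<longleftrightarrow>
     (\<forall>w. \<forall>s::'k. s ^ count_list ws w = s ^ count_list ws' w)"
proof
  assume "(monomial ws :: ('a \<Rightarrow> 'k) \<Rightarrow> 'k) = monomial ws'"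
  then show "\<forall>w. \<forall>s::'k. s ^ count_list ws w = s ^ count_list ws' w"
    by (metis monomial_single)
next
  assume "\<forall>w. \<forall>s::'k. s ^ count_list ws w = s ^ count_list ws' w"
  then show "(monomial ws :: ('a \<Rightarrow> 'k) \<Rightarrow> 'k) = monomial ws'"
    by (intro ext) (simp add: monomial_eq_prod_count[of "set ws \<union> set ws'"])
qed

section \<open>Expansion of \<open>n\<close>-th powers along characters\<close>

definition word_sum :: "word list set \<Rightarrow> word \<Rightarrow>\<^sub>0 'k::field" where
  "word_sum S = (\<Sum>ws\<in>S. Poly_Mapping.single (sum_list ws) 1)"

text \<open>\<open>word_sum (fibre W n \<chi>)\<close> is the coefficient of the character
  \<open>\<chi>\<close> in the \<open>n\<close>-th power of a general combination of the words in
  \<open>W\<close>.\<close>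

definition fibre :: "'a set \<Rightarrow> nat \<Rightarrow> (('a \<Rightarrow> 'k::comm_monoid_mult) \<Rightarrow> 'k) \<Rightarrow> 'a list set" where
  "fibre W n \<chi> = {ws. set ws \<subseteq> W \<and> length ws = n \<and> monomial ws = \<chi>}"

lemma finite_fibre: "finite W \<Longrightarrow> finite (fibre W n \<chi>)"
  unfolding fibre_def by (rule finite_subset[OF _ finite_lists_length_eq[of W n]]) auto

lemma sum_single_power:
  fixes t :: "word \<Rightarrow> 'k::field"
  assumes "finite W"
  shows "(\<Sum>w\<in>W. Poly_Mapping.single w (t w)) ^ n =
    (\<Sum>ws | set ws \<subseteq> W \<and> length ws = n. Poly_Mapping.single (sum_list ws) (monomial ws t))"
proof (induction n)
  case 0
  have "{ws. set ws \<subseteq> W \<and> length ws = 0} = {[]}" by auto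
  then show ?case by (simp add: monomial_def)
next
  case (Suc n)
  let ?B = "{ws. set ws \<subseteq> W \<and> length ws = n}"
  have "(\<Sum>ws | set ws \<subseteq> W \<and> length ws = Suc n. Poly_Mapping.single (sum_list ws) (monomial ws t))
     = (\<Sum>(ws, w)\<in>?B \<times> W. Poly_Mapping.single (w + sum_list ws) (t w * monomial ws t))"
    unfolding lists_length_Suc_eq
    by (subst sum.reindex) (auto simp: inj_on_def monomial_def intro!: sum.cong)
  also have "\<dots> = (\<Sum>ws\<in>?B. \<Sum>w\<in>W. Poly_Mapping.single w (t w) * Poly_Mapping.single (sum_list ws) (monomial ws t))"
    by (simp add: sum.cartesian_product mult_single)
  also have "\<dots> = (\<Sum>w\<in>W. Poly_Mapping.single w (t w)) *
      (\<Sum>ws\<in>?B. Poly_Mapping.single (sum_list ws) (monomial ws t))"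
    by (simp add: sum_distrib_left sum_distrib_right sum.swap[of _ W])
  finally show ?case using Suc by simp
qed

lemma power_eq_sum_characters:
  fixes t :: "word \<Rightarrow> 'k::field"
  assumes "finite W"
  shows "(\<Sum>w\<in>W. Poly_Mapping.single w (t w)) ^ n =
    (\<Sum>\<chi>\<in>monomial ` {ws. set ws \<subseteq> W \<and> length ws = n}.
      Poly_Mapping.single 0 (\<chi> t) * word_sum (fibre W n \<chi>))"
proof -
  let ?B = "{ws. set ws \<subseteq> W \<and> length ws = n}"
  have "(\<Sum>ws | ws \<in> ?B \<and> monomial ws = \<chi>. Poly_Mapping.single (sum_list ws) (monomial ws t))
      = Poly_Mapping.single 0 (\<chi> t) * word_sum (fibre W n \<chi>)" for \<chi> :: "(word \<Rightarrow> 'k) \<Rightarrow> 'k"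
    unfolding word_sum_def sum_distrib_left
    by (rule sum.cong) (auto simp: fibre_def mult_single)
  then show ?thesis
    unfolding sum_single_power[OF assms]
    by (subst sum.image_gen[OF finite_lists_length_eq[OF assms], of _ _ monomial])
      (rule sum.cong[OF refl])
qed

lemma subspace_power_ideal:
  "0 < n \<Longrightarrow> word_algebra.subspace (power_ideal n d :: (word \<Rightarrow>\<^sub>0 'k::field) set)"
  using algebra_ideal_power_ideal[of n d, where ?'k = 'k]
  unfolding algebra_ideal_def word_algebra.subspace_def by blast

lemma power_in_power_ideal: "x \<in> free_algebra d \<Longrightarrow> x ^ n \<in> power_ideal n d"
  unfolding power_ideal_def generated_ideal_def by blast

lemma single_in_free_algebra: "w \<in> free_semigroup d \<Longrightarrow> Poly_Mapping.single w c \<in> free_algebra d"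
  by (simp add: free_algebra_def)

lemma sum_in_free_algebra: "(\<And>i. i \<in> I \<Longrightarrow> f i \<in> free_algebra d) \<Longrightarrow> sum f I \<in> free_algebra d"
  by (induction I rule: infinite_finite_induct) (auto simp: free_algebra_closed)

text \<open>The ideal contains the \<open>n\<close>-th power for every choice \<open>t\<close> of
  coefficients. Monomials are characters for pointwise multiplication of coefficients, so
  independence puts each summand into the ideal separately.\<close>

lemma word_sum_fibre_in_power_ideal:
  fixes \<chi> :: "(word \<Rightarrow> 'k::field) \<Rightarrow> 'k"
  assumes "0 < n" and "finite W" and "W \<subseteq> free_semigroup d"
    and "\<chi> \<in> monomial ` {ws. set ws \<subseteq> W \<and> length ws = n}"
  shows "word_sum (fibre W n \<chi>) \<in> (power_ideal n d :: (word \<Rightarrow>\<^sub>0 'k) set)"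
proof (rule word_algebra.characters_independent[where v = "\<lambda>\<chi>. word_sum (fibre W n \<chi>)"
      and m = "\<lambda>s t w. s w * t w" and e = "\<lambda>_. 1"])
  show "word_algebra.subspace (power_ideal n d :: (word \<Rightarrow>\<^sub>0 'k) set)"
    by (rule subspace_power_ideal[OF assms(1)])
  show "finite (monomial ` {ws. set ws \<subseteq> W \<and> length ws = n} :: ((word \<Rightarrow> 'k) \<Rightarrow> 'k) set)"
    by (intro finite_imageI finite_lists_length_eq assms(2))
  show "(\<Sum>\<chi>\<in>monomial ` {ws. set ws \<subseteq> W \<and> length ws = n}.
      Poly_Mapping.single 0 (\<chi> t) * word_sum (fibre W n \<chi>)) \<in> (power_ideal n d :: (word \<Rightarrow>\<^sub>0 'k) set)" for t
    unfolding power_eq_sum_characters[OF assms(2), symmetric]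
    by (intro power_in_power_ideal sum_in_free_algebra single_in_free_algebra) (use assms(3) in blast)
qed (use assms(4) in \<open>auto simp: monomial_one monomial_mult\<close>)

text \<open>An empty \<open>u\<close> gives the unit, which lies outside
  \<open>free_algebra d\<close>; the remaining words are covered by the ideal property.\<close>

lemma word_mult_power_ideal:
  fixes x :: "word \<Rightarrow>\<^sub>0 'k::field"
  assumes "0 < n" and "x \<in> power_ideal n d" and "set (letters u) \<subseteq> {..<d}"
  shows "Poly_Mapping.single u 1 * x \<in> power_ideal n d"
    and "x * Poly_Mapping.single u 1 \<in> power_ideal n d"
proof -
  have "u = 0 \<or> u \<in> free_semigroup d"
    using assms(3) by (cases u) (auto simp: free_semigroup_def zero_word_def)
  then show "Poly_Mapping.single u 1 * x \<in> power_ideal n d"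
    and "x * Poly_Mapping.single u 1 \<in> power_ideal n d"
    using algebra_ideal_power_ideal[OF assms(1), of d, where ?'k = 'k] assms(2)
      single_in_free_algebra[of u d 1] unfolding algebra_ideal_def by auto
qed

section \<open>Spanning elements of the ideal and their transfer between fields\<close>

text \<open>The index triple involves words only, so the same triple denotes an element over either
  field.\<close>

definition context_sum :: "word \<times> word list set \<times> word \<Rightarrow> word \<Rightarrow>\<^sub>0 'k::field" where
  "context_sum = (\<lambda>(u, S, v). Poly_Mapping.single u 1 * word_sum S * Poly_Mapping.single v 1)"

text \<open>The coefficients are images of natural numbers that depend on the index only. This turns
  membership in the span into a linear system over the integers.\<close>

lemma lookup_context_sum:
  assumes "finite S"
  shows "Poly_Mapping.lookup (context_sum (u, S, v)) w = of_nat (card {ws \<in> S. u + sum_list ws + v = w})"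
  using assms
  by (simp add: context_sum_def word_sum_def sum_distrib_left sum_distrib_right mult_single
      lookup_sum lookup_single when_def sum.If_cases Int_def)

definition power_ideal_generators :: "'k::field itself \<Rightarrow> nat \<Rightarrow> nat \<Rightarrow> (word \<times> word list set \<times> word) set" where
  "power_ideal_generators _ n d = {(u, fibre W n \<chi>, v) | u v W (\<chi> :: (word \<Rightarrow> 'k) \<Rightarrow> 'k).
     set (letters u) \<subseteq> {..<d} \<and> set (letters v) \<subseteq> {..<d} \<and> finite W \<and> W \<subseteq> free_semigroup d \<and>
     \<chi> \<in> monomial ` {ws. set ws \<subseteq> W \<and> length ws = n}}"

lemma power_ideal_generatorsE:
  assumes "j \<in> power_ideal_generators TYPE('k::field) n d"
  obtains u v W and \<chi> :: "(word \<Rightarrow> 'k::field) \<Rightarrow> 'k" where "j = (u, fibre W n \<chi>, v)"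
    "set (letters u) \<subseteq> {..<d}" "set (letters v) \<subseteq> {..<d}" "finite W" "W \<subseteq> free_semigroup d"
    "\<chi> \<in> monomial ` {ws. set ws \<subseteq> W \<and> length ws = n}"
  using assms unfolding power_ideal_generators_def by blast

lemma power_ideal_generatorsI:
  fixes \<chi> :: "(word \<Rightarrow> 'k::field) \<Rightarrow> 'k"
  assumes "set (letters u) \<subseteq> {..<d}" "set (letters v) \<subseteq> {..<d}" "finite W" "W \<subseteq> free_semigroup d"
    "\<chi> \<in> monomial ` {ws. set ws \<subseteq> W \<and> length ws = n}"
  shows "(u, fibre W n \<chi>, v) \<in> power_ideal_generators TYPE('k) n d"
  using assms unfolding power_ideal_generators_def by blast

lemma context_sum_in_power_ideal:
  assumes "0 < n" and "j \<in> power_ideal_generators TYPE('k::field) n d"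
  shows "context_sum j \<in> (power_ideal n d :: (word \<Rightarrow>\<^sub>0 'k) set)"
  using assms(2) unfolding context_sum_def
  by (elim power_ideal_generatorsE)
    (simp add: assms(1) word_mult_power_ideal word_sum_fibre_in_power_ideal)

text \<open>The span is itself an ideal, since multiplying by a word only enlarges the outer
  context, and it contains all \<open>n\<close>-th powers by their expansion along
  characters.\<close>

lemma power_ideal_subset_span:
  assumes "0 < n"
  shows "(power_ideal n d :: (word \<Rightarrow>\<^sub>0 'k::field) set) \<subseteq>
    word_algebra.span (context_sum ` power_ideal_generators TYPE('k) n d)" (is "_ \<subseteq> ?V")
proof -
  let ?G = "power_ideal_generators TYPE('k) n d"
  let ?A = "free_algebra d :: (word \<Rightarrow>\<^sub>0 'k) set"
  have letters_add: "letters (u + v) = letters u @ letters v" for u v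
    by (simp add: plus_word_def)
  have sub: "word_algebra.subspace ?V" by (rule word_algebra.subspace_span)
  have left: "a * x \<in> ?V" if "a \<in> ?A" "x \<in> ?V" for a x
    using that(2)
  proof (induction rule: word_algebra.span_induct_alt)
    case (step c g x)
    then obtain u v W and \<chi> :: "(word \<Rightarrow> 'k) \<Rightarrow> 'k" where g: "g = context_sum (u, fibre W n \<chi>, v)"
      "set (letters u) \<subseteq> {..<d}" "set (letters v) \<subseteq> {..<d}" "finite W" "W \<subseteq> free_semigroup d"
      "\<chi> \<in> monomial ` {ws. set ws \<subseteq> W \<and> length ws = n}"
      by (elim imageE power_ideal_generatorsE) simp
    have "a * g = (\<Sum>w\<in>Poly_Mapping.keys a. Poly_Mapping.single 0 (Poly_Mapping.lookup a w) *
        context_sum (w + u, fibre W n \<chi>, v))"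
      by (subst poly_mapping_sum_single[of a, symmetric])
        (simp add: g(1) context_sum_def sum_distrib_right mult_single mult.assoc[symmetric])
    also have "\<dots> \<in> ?V"
    proof (intro word_algebra.span_sum word_algebra.span_scale word_algebra.span_base imageI power_ideal_generatorsI)
      show "set (letters (w + u)) \<subseteq> {..<d}" if "w \<in> Poly_Mapping.keys a" for w
        using that g \<open>a \<in> ?A\<close> by (auto simp: letters_add free_algebra_def free_semigroup_def)
    qed (use g in auto)
    finally have "a * g \<in> ?V" .
    then have "Poly_Mapping.single 0 c * (a * g) + a * x \<in> ?V"
      using step by (intro word_algebra.span_add word_algebra.span_scale)
    then show ?case
      by (simp add: distrib_left mult.assoc[symmetric] single_zero_commute)
  qed (simp add: word_algebra.span_zero)
  have right: "x * a \<in> ?V" if "a \<in> ?A" "x \<in> ?V" for a x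
    using that(2)
  proof (induction rule: word_algebra.span_induct_alt)
    case (step c g x)
    then obtain u v W and \<chi> :: "(word \<Rightarrow> 'k) \<Rightarrow> 'k" where g: "g = context_sum (u, fibre W n \<chi>, v)"
      "set (letters u) \<subseteq> {..<d}" "set (letters v) \<subseteq> {..<d}" "finite W" "W \<subseteq> free_semigroup d"
      "\<chi> \<in> monomial ` {ws. set ws \<subseteq> W \<and> length ws = n}"
      by (elim imageE power_ideal_generatorsE) simp
    have "Poly_Mapping.single v 1 * Poly_Mapping.single w (b::'k)
        = Poly_Mapping.single (v + w) 1 * Poly_Mapping.single 0 b" for w b
      by (simp add: mult_single)
    then have "g * a = (\<Sum>w\<in>Poly_Mapping.keys a. Poly_Mapping.single 0 (Poly_Mapping.lookup a w) *
        context_sum (u, fibre W n \<chi>, v + w))"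
      by (subst poly_mapping_sum_single[of a, symmetric])
        (simp add: g(1) context_sum_def sum_distrib_left mult.assoc flip: single_zero_commute)
    also have "\<dots> \<in> ?V"
    proof (intro word_algebra.span_sum word_algebra.span_scale word_algebra.span_base imageI power_ideal_generatorsI)
      show "set (letters (v + w)) \<subseteq> {..<d}" if "w \<in> Poly_Mapping.keys a" for w
        using that g \<open>a \<in> ?A\<close> by (auto simp: letters_add free_algebra_def free_semigroup_def)
    qed (use g in auto)
    finally have "g * a \<in> ?V" .
    then have "Poly_Mapping.single 0 c * (g * a) + x * a \<in> ?V"
      using step by (intro word_algebra.span_add word_algebra.span_scale)
    then show ?case by (simp add: distrib_right mult.assoc)
  qed (simp add: word_algebra.span_zero)
  \<comment> \<open>An ideal must be a subset of \<open>?A\<close>; this comes from the inclusion of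
    \<open>?V\<close> in \<open>power_ideal n d\<close>.\<close>
  have "context_sum ` ?G \<subseteq> (power_ideal n d :: (word \<Rightarrow>\<^sub>0 'k) set)"
    by (intro image_subsetI context_sum_in_power_ideal[OF assms])
  then have "?V \<subseteq> power_ideal n d"
    by (rule word_algebra.span_minimal[OF _ subspace_power_ideal[OF assms]])
  then have "?V \<subseteq> ?A"
    using algebra_ideal_power_ideal[OF assms, of d, where ?'k = 'k] unfolding algebra_ideal_def by blast
  then have "algebra_ideal ?A ?V"
    using left right sub unfolding algebra_ideal_def word_algebra.subspace_def by blast
  moreover have "x ^ n \<in> ?V" if "x \<in> ?A" for x
  proof -
    let ?W = "Poly_Mapping.keys x"
    have W: "finite ?W" "?W \<subseteq> free_semigroup d" using that by (auto simp: free_algebra_def)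
    have "word_sum (fibre ?W n \<chi>) \<in> ?V" if "\<chi> \<in> monomial ` {ws. set ws \<subseteq> ?W \<and> length ws = n}"
      for \<chi> :: "(word \<Rightarrow> 'k) \<Rightarrow> 'k"
    proof -
      have "context_sum (0, fibre ?W n \<chi>, 0) \<in> ?V"
        by (intro word_algebra.span_base imageI power_ideal_generatorsI) (use W that in \<open>auto simp: zero_word_def\<close>)
      then show ?thesis by (simp add: context_sum_def)
    qed
    then show ?thesis
      using power_eq_sum_characters[OF W(1), of "Poly_Mapping.lookup x" n]
      by (simp add: poly_mapping_sum_single word_algebra.span_sum word_algebra.span_scale)
  qed
  ultimately show ?thesis
    unfolding power_ideal_def generated_ideal_def by blast
qed

text \<open>By \<open>refine\<close> each fibre over \<open>'f\<close> is a disjoint union of fibres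
  over \<open>'l\<close>, so the generators indexed over \<open>'f\<close> lie in the ideal over
  \<open>'l\<close> too. The system that expresses \<open>x\<close> by them has integer coefficients
  and hence stays solvable over \<open>'l\<close>.\<close>

lemma single_in_power_ideal_transfer:
  assumes "0 < n" and "CHAR('f::field) > 0" and "CHAR('l::field) = CHAR('f)"
    and refine: "\<And>ws ws' :: word list. length ws = n \<Longrightarrow> length ws' = n \<Longrightarrow>
      (monomial ws :: (word \<Rightarrow> 'l) \<Rightarrow> 'l) = monomial ws' \<Longrightarrow>
      (monomial ws :: (word \<Rightarrow> 'f) \<Rightarrow> 'f) = monomial ws'"
    and "Poly_Mapping.single x 1 \<in> (power_ideal n d :: (word \<Rightarrow>\<^sub>0 'f) set)"
  shows "Poly_Mapping.single x 1 \<in> (power_ideal n d :: (word \<Rightarrow>\<^sub>0 'l) set)"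
proof -
  let ?G = "power_ideal_generators TYPE('f) n d"
  have generator: "context_sum j \<in> (power_ideal n d :: (word \<Rightarrow>\<^sub>0 'l) set)" if j: "j \<in> ?G" for j
  proof -
    obtain u v W and \<chi> :: "(word \<Rightarrow> 'f) \<Rightarrow> 'f" where j: "j = (u, fibre W n \<chi>, v)"
      "set (letters u) \<subseteq> {..<d}" "set (letters v) \<subseteq> {..<d}" "finite W" "W \<subseteq> free_semigroup d"
      using j by (rule power_ideal_generatorsE)
    let ?S = "fibre W n \<chi>"
    have fib: "{ws \<in> ?S. monomial ws = \<psi>} = fibre W n \<psi>" if "\<psi> \<in> monomial ` ?S"
      for \<psi> :: "(word \<Rightarrow> 'l) \<Rightarrow> 'l"
    proof (intro equalityI subsetI)
      fix ws assume ws: "ws \<in> fibre W n \<psi>"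
      from that obtain ws' where ws': "ws' \<in> ?S" "\<psi> = monomial ws'" by blast
      have "(monomial ws :: (word \<Rightarrow> 'f) \<Rightarrow> 'f) = monomial ws'"
        by (rule refine) (use ws ws' in \<open>simp_all add: fibre_def\<close>)
      then show "ws \<in> {ws \<in> ?S. monomial ws = \<psi>}"
        using ws ws'(1) by (simp add: fibre_def)
    qed (simp add: fibre_def)
    have "word_sum ?S = (\<Sum>\<psi>\<in>(monomial :: _ \<Rightarrow> (word \<Rightarrow> 'l) \<Rightarrow> 'l) ` ?S.
        word_sum (fibre W n \<psi>) :: word \<Rightarrow>\<^sub>0 'l)"
      unfolding word_sum_def
      by (subst sum.image_gen[OF finite_fibre[OF j(4)], where g = "monomial :: _ \<Rightarrow> (word \<Rightarrow> 'l) \<Rightarrow> 'l"])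
        (rule sum.cong[OF refl sum.cong[OF fib refl]])
    also have "\<dots> \<in> power_ideal n d"
      by (rule word_algebra.subspace_sum[OF subspace_power_ideal[OF assms(1)]],
          rule word_sum_fibre_in_power_ideal[OF assms(1) j(4,5)])
        (auto simp: fibre_def)
    finally show ?thesis
      using j(1-3) by (simp add: context_sum_def assms(1) word_mult_power_ideal)
  qed
  have "Poly_Mapping.single x 1 \<in> word_algebra.span (context_sum ` ?G :: (word \<Rightarrow>\<^sub>0 'f) set)"
    using power_ideal_subset_span[OF assms(1)] assms(5) by blast
  then obtain T and r :: "_ \<Rightarrow> 'f" where T: "finite T" "T \<subseteq> context_sum ` ?G"
    "Poly_Mapping.single x 1 = (\<Sum>g\<in>T. Poly_Mapping.single 0 (r g) * g)"
    unfolding word_algebra.span_explicit by blast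
  \<comment> \<open>One index is chosen for each element of \<open>T\<close>, so that the sum over
    \<open>T\<close> becomes a sum over \<open>J\<close>.\<close>
  then obtain J where J: "J \<subseteq> ?G" "inj_on (context_sum :: _ \<Rightarrow> word \<Rightarrow>\<^sub>0 'f) J" "T = context_sum ` J"
    using T(2) unfolding subset_image_inj by blast
  have finJ: "finite J" using J T(1) finite_imageD by blast
  define a :: "word \<times> word list set \<times> word \<Rightarrow> word \<Rightarrow> int" where
    "a = (\<lambda>(u, S, v) w. int (card {ws \<in> S. u + sum_list ws + v = w}))"
  have a: "Poly_Mapping.lookup (context_sum j :: word \<Rightarrow>\<^sub>0 'k::field) w = of_int (a j w)"
    if "j \<in> J" for j w
  proof -
    have "j \<in> ?G" using that J(1) by blast
    then show ?thesis by (elim power_ideal_generatorsE) (simp add: lookup_context_sum finite_fibre a_def)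
  qed
  have lookup_comb: "Poly_Mapping.lookup (\<Sum>j\<in>J. Poly_Mapping.single 0 (y j) * context_sum j) w
      = (\<Sum>j\<in>J. of_int (a j w) * y j)" for y :: "_ \<Rightarrow> 'k::field" and w
    unfolding lookup_sum
    by (intro sum.cong refl)
      (simp add: a map.rep_eq when_def mult.commute flip: mult_map_scale_conv_mult)
  \<comment> \<open>There is one equation per word \<open>w\<close>; its right-hand side is the
    coefficient of \<open>w\<close> in the basis element of \<open>x\<close>.\<close>
  have "(\<Sum>j\<in>J. of_int (a j w) * r (context_sum j)) = of_int (if x = w then 1 else 0)" for w
    using arg_cong[OF T(3), of "\<lambda>f. Poly_Mapping.lookup f w"]
    unfolding J(3) sum.reindex[OF J(2)] comp_def lookup_comb
    by (auto simp: lookup_single when_def)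
  then have "\<exists>y :: _ \<Rightarrow> 'l. \<forall>w. (\<Sum>j\<in>J. of_int (a j w) * y j) = of_int (if x = w then 1 else 0)"
    by (rule linear_system_solvable_transfer[OF finJ assms(2,3)])
  then obtain y :: "_ \<Rightarrow> 'l" where
    y: "\<And>w. (\<Sum>j\<in>J. of_int (a j w) * y j) = of_int (if x = w then 1 else 0)" by blast
  have "Poly_Mapping.single x 1 = (\<Sum>j\<in>J. Poly_Mapping.single 0 (y j) * context_sum j)"
    by (rule poly_mapping_eqI) (unfold lookup_comb y, simp add: lookup_single when_def)
  also have "\<dots> \<in> power_ideal n d"
    by (intro word_algebra.subspace_sum word_algebra.subspace_scale subspace_power_ideal[OF assms(1)] generator)
      (use J(1) in blast)
  finally show ?thesis .
qed

subsection \<open>Nilpotency\<close>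

text \<open>This is the multilinear identity: over any field, a sequence of the same length in the
  same distinct words has the same monomial function only if it is a rearrangement.\<close>

lemma word_sum_permutations_in_power_ideal:
  assumes "distinct us" and "us \<noteq> []" and "set us \<subseteq> free_semigroup d"
  shows "word_sum {ws. mset ws = mset us} \<in> (power_ideal (length us) d :: (word \<Rightarrow>\<^sub>0 'k::field) set)"
    and "finite {ws. mset ws = mset us}"
proof -
  have "{ws. mset ws = mset us} = fibre (set us) (length us) (monomial us :: (word \<Rightarrow> 'k) \<Rightarrow> 'k)"
  proof (intro equalityI subsetI)
    fix ws assume "ws \<in> {ws. mset ws = mset us}"
    then show "ws \<in> fibre (set us) (length us) (monomial us :: (word \<Rightarrow> 'k) \<Rightarrow> 'k)"
      using mset_eq_setD[of ws us] mset_eq_length[of ws us] monomial_eq_if_mset_eq[of ws us]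
      by (simp add: fibre_def)
  next
    fix ws assume "ws \<in> fibre (set us) (length us) (monomial us :: (word \<Rightarrow> 'k) \<Rightarrow> 'k)"
    then have ws: "set ws \<subseteq> set us" "length ws = length us"
      "(monomial ws :: (word \<Rightarrow> 'k) \<Rightarrow> 'k) = monomial us" by (simp_all add: fibre_def)
    have "count_list ws w \<noteq> 0" if "w \<in> set us" for w
    proof
      assume "count_list ws w = 0"
      \<comment> \<open>Evaluation at 0 tells a present word from an absent one, because
        \<open>0 ^ 0 = 1\<close>.\<close>
      then have "(0::'k) ^ count_list us w = 1"
        using ws(3) unfolding monomial_eq_iff by (metis power_0)
      then show False using that by (simp add: power_0_left count_list_0_iff split: if_splits)
    qed
    then have set: "set ws = set us" using ws(1) by (auto simp: count_list_0_iff)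
    then have "distinct ws" using ws(2) assms(1) by (metis card_distinct distinct_card)
    then show "ws \<in> {ws. mset ws = mset us}" using set assms(1) by (simp add: set_eq_iff_mset_eq_distinct)
  qed
  then show "word_sum {ws. mset ws = mset us} \<in> (power_ideal (length us) d :: (word \<Rightarrow>\<^sub>0 'k) set)"
    and "finite {ws. mset ws = mset us}"
    using word_sum_fibre_in_power_ideal[of "length us" "set us" d "monomial us :: (word \<Rightarrow> 'k) \<Rightarrow> 'k"]
      assms(2,3) by (simp_all add: finite_fibre)
qed

lemma sum_list_map_Word: "sum_list (map Word us) = Word (concat us)"
  by (induction us) (simp_all add: zero_word_def plus_word_def)

lemma single_Word_append:
  "Poly_Mapping.single (Word (a @ b)) (1::'k::field) = Poly_Mapping.single (Word a) 1 * Poly_Mapping.single (Word b) 1"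
  by (simp add: mult_single plus_word_def)

lemma single_Word_power:
  "Poly_Mapping.single (Word u) (1::'k::field) ^ n = Poly_Mapping.single (Word (concat (replicate n u))) 1"
  by (induction n) (simp_all add: zero_word_def[symmetric] single_Word_append)

text \<open>A long word contains an \<open>n\<close>-th power or a decreasing factorization. In the
  latter case the multilinear identity rewrites it, modulo the ideal, as minus a sum of
  lexicographically smaller words of the same length, which allows induction.\<close>

lemma single_in_power_ideal_if_long:
  assumes "0 < n"
  obtains c where "0 < c" and "\<And>w. set (letters w) \<subseteq> {..<d} \<Longrightarrow> length (letters w) = c \<Longrightarrow>
    Poly_Mapping.single w 1 \<in> (power_ideal n d :: (word \<Rightarrow>\<^sub>0 'k::field) set)"
proof -
  let ?I = "power_ideal n d :: (word \<Rightarrow>\<^sub>0 'k) set"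
  note sub = subspace_power_ideal[OF assms, of d, where ?'k = 'k]
  define L where "L = {l. set l \<subseteq> {..<d} \<and> (\<forall>u. u \<noteq> [] \<longrightarrow> \<not> sublist (concat (replicate n u)) l) \<and>
    (\<forall>us. length us = n \<and> lex_decreasing us \<longrightarrow> \<not> sublist (concat us) l)}"
  have "\<exists>b. \<forall>l\<in>L. length l < b"
  proof (rule bounded_language_if_no_powers_no_decreasing[OF _ assms])
    show "finite {..<d}" by simp
    show "v \<in> L" if "w \<in> L" "sublist v w" for v w
      using that set_mono_sublist[OF that(2)] sublist_order.order_trans unfolding L_def by blast
  qed (auto simp: L_def)
  then obtain b where b: "\<And>l. l \<in> L \<Longrightarrow> length l < b" by blast
  \<comment> \<open>Words of length \<open>Suc b\<close> are outside \<open>L\<close>, and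
    \<open>Suc b\<close> is positive as required of \<open>c\<close>.\<close>
  have "Poly_Mapping.single (Word l) 1 \<in> ?I" if "set l \<subseteq> {..<d}" "length l = Suc b" for l
    using that
  proof (induction l rule: wf_induct_rule[OF wf_lex[OF wf_less_than]])
    case (1 l)
    have "l \<notin> L" using b[of l] 1 by auto
    then consider (power) u where "u \<noteq> []" "sublist (concat (replicate n u)) l"
      | (decreasing) us where "length us = n" "lex_decreasing us" "sublist (concat us) l"
      using 1 unfolding L_def by blast
    then show ?case
    proof cases
      case power
      then obtain p q where l: "l = p @ concat (replicate n u) @ q" by (auto simp: sublist_def)
      then have "Word u \<in> free_semigroup d"
        using 1 power(1) assms by (auto simp: free_semigroup_def)
      then have "Poly_Mapping.single (Word u) 1 ^ n \<in> ?I"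
        by (intro power_in_power_ideal single_in_free_algebra)
      then show ?thesis
        unfolding l single_Word_append single_Word_power[symmetric]
        using 1 l by (intro word_mult_power_ideal[OF assms]) auto
    next
      case decreasing
      then obtain p q where l: "l = p @ concat us @ q" by (auto simp: sublist_def)
      let ?us = "map Word us"
      let ?S = "{ws. mset ws = mset ?us}"
      let ?f = "\<lambda>ws. Poly_Mapping.single (Word p + sum_list ws + Word q) (1::'k)"
      have nonempty: "[] \<notin> set us" using decreasing(2) unfolding lex_decreasing_def by force
      have us: "distinct ?us" "?us \<noteq> []" "set ?us \<subseteq> free_semigroup d" "length ?us = n"
        using lex_decreasing_distinct[OF decreasing(2)] decreasing(1) assms 1(2) l nonempty
        by (fastforce simp: distinct_map inj_on_def free_semigroup_def)+
      have fin: "finite ?S" using word_sum_permutations_in_power_ideal(2)[OF us(1-3)] .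
      have pq: "set p \<subseteq> {..<d}" "set q \<subseteq> {..<d}" using 1 l by auto
      have "word_sum ?S \<in> ?I"
        using word_sum_permutations_in_power_ideal(1)[OF us(1-3), where ?'k = 'k] us(4) by simp
      then have "Poly_Mapping.single (Word p) 1 * word_sum ?S * Poly_Mapping.single (Word q) 1 \<in> ?I"
        using pq by (intro word_mult_power_ideal[OF assms]) simp_all
      then have "(\<Sum>ws\<in>?S. ?f ws) \<in> ?I"
        by (simp add: word_sum_def sum_distrib_left sum_distrib_right mult_single)
      \<comment> \<open>Every other rearrangement concatenates to a smaller word and falls under the
        induction hypothesis.\<close>
      moreover have "(\<Sum>ws\<in>?S - {?us}. ?f ws) \<in> ?I"
      proof (rule word_algebra.subspace_sum[OF sub])
        fix ws assume ws: "ws \<in> ?S - {?us}"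
        define vs where "vs = map letters ws"
        have vs: "ws = map Word vs" by (simp add: vs_def comp_def)
        have "mset vs = mset us"
          using ws arg_cong[of "mset ws" "mset ?us" "image_mset letters"]
          by (simp add: vs_def image_mset.compositionality comp_def)
        moreover from this have "length (concat us) = length (concat vs)"
          unfolding length_concat by (metis mset_map sum_mset_sum_list)
        moreover have "vs \<noteq> us" using ws vs by auto
        ultimately have less: "(p @ concat vs @ q, l) \<in> lex less_than"
          unfolding l
          by (intro lex_append_leftI lex_append_rightI concat_less_concat_lex_decreasing decreasing(2)) auto
        have "set vs = set us" using \<open>mset vs = mset us\<close> by (rule mset_eq_setD)
        then have "Poly_Mapping.single (Word (p @ concat vs @ q)) 1 \<in> ?I"
          using 1 l \<open>length (concat us) = length (concat vs)\<close> by (intro 1(1)[OF less]) auto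
        then show "?f ws \<in> ?I"
          unfolding vs sum_list_map_Word by (simp add: plus_word_def)
      qed
      ultimately have "(\<Sum>ws\<in>?S. ?f ws) - (\<Sum>ws\<in>?S - {?us}. ?f ws) \<in> ?I"
        by (rule word_algebra.subspace_diff[OF sub])
      moreover have "(\<Sum>ws\<in>?S. ?f ws) - (\<Sum>ws\<in>?S - {?us}. ?f ws) = ?f ?us"
        using fin by (subst sum.remove[of _ ?us]) auto
      ultimately show ?thesis
        unfolding l sum_list_map_Word by (simp add: plus_word_def)
    qed
  qed
  then have "Poly_Mapping.single w 1 \<in> ?I" if "set (letters w) \<subseteq> {..<d}" "length (letters w) = Suc b" for w
    using that by (metis word.collapse)
  then show thesis using that by blast
qed

section \<open>Reduction from products of cosets to words\<close>

lemma prod_list_in_free_algebra: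
  "xs \<noteq> [] \<Longrightarrow> set xs \<subseteq> free_algebra d \<Longrightarrow> prod_list xs \<in> free_algebra d"
  by (induction xs rule: list_nonempty_induct) (simp_all add: free_algebra_closed)

lemma N_prod_classes:
  fixes xs :: "(word \<Rightarrow>\<^sub>0 'k::field) list"
  assumes "0 < n" and "xs \<noteq> []" and "set xs \<subseteq> free_algebra d"
  shows "N_prod n d (map (\<lambda>x. power_rel n d `` {x}) xs) = power_rel n d `` {prod_list xs}"
  using assms(2,3)
proof (induction xs rule: rev_nonempty_induct)
  case (snoc x xs)
  have "N_prod n d (map (\<lambda>x. power_rel n d `` {x}) (xs @ [x])) =
      N_mult n d (N_prod n d (map (\<lambda>x. power_rel n d `` {x}) xs)) (power_rel n d `` {x})"
    using snoc.hyps by (simp add: N_prod_def)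
  then show ?case
    using snoc assms(1) by (simp add: N_mult_class prod_list_in_free_algebra)
qed (simp add: N_prod_def)

lemma power_rel_class_eq_N_zero_iff:
  assumes "0 < n" and "x \<in> free_algebra d"
  shows "power_rel n d `` {x} = N_zero n d \<longleftrightarrow> x \<in> power_ideal n d"
  unfolding N_zero_def
  by (subst eq_equiv_class_iff[OF equiv_power_rel[OF assms(1)]])
    (use assms(2) in \<open>simp_all add: free_algebra_closed power_rel_def\<close>)

lemma keys_prod_list_free_algebra:
  assumes "set xs \<subseteq> (free_algebra d :: (word \<Rightarrow>\<^sub>0 'k::field) set)"
  shows "Poly_Mapping.keys (prod_list xs) \<subseteq> {w. set (letters w) \<subseteq> {..<d} \<and> length xs \<le> length (letters w)}"
  using assms
proof (induction xs)
  case (Cons x xs)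
  show ?case
  proof
    fix w assume "w \<in> Poly_Mapping.keys (prod_list (x # xs))"
    then obtain u v where w: "w = u + v" "u \<in> Poly_Mapping.keys x" "v \<in> Poly_Mapping.keys (prod_list xs)"
      using keys_mult[of x "prod_list xs"] by auto
    then have "u \<in> free_semigroup d" "set (letters v) \<subseteq> {..<d}" "length xs \<le> length (letters v)"
      using Cons by (auto simp: free_algebra_def)
    then show "w \<in> {w. set (letters w) \<subseteq> {..<d} \<and> length (x # xs) \<le> length (letters w)}"
      unfolding w(1) by (cases "letters u") (auto simp: free_semigroup_def plus_word_def)
  qed
qed (simp add: zero_word_def)

lemma single_Word_eq_prod_list:
  "Poly_Mapping.single (Word l) (1::'k::field) = prod_list (map (\<lambda>i. Poly_Mapping.single (Word [i]) 1) l)"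
proof (induction l)
  case (Cons i l)
  then show ?case using single_Word_append[of "[i]" l, where ?'k = 'k] by simp
qed (simp add: zero_word_def[symmetric])

text \<open>A word of length \<open>c\<close> is a product of \<open>c\<close> letters. Conversely,
  every word in a product of \<open>c\<close> elements has at least \<open>c\<close> letters, and
  its prefix of length \<open>c\<close> already lies in the ideal.\<close>

lemma nilpotent_iff_long_words_in_power_ideal:
  assumes "0 < n" and "0 < c"
  shows "(\<forall>as. length as = c \<and> set as \<subseteq> (N_carrier n d :: (word \<Rightarrow>\<^sub>0 'k::field) set set) \<longrightarrow>
      N_prod n d as = N_zero n d) \<longleftrightarrow>
    (\<forall>w. set (letters w) \<subseteq> {..<d} \<and> length (letters w) = c \<longrightarrow>
      Poly_Mapping.single w 1 \<in> (power_ideal n d :: (word \<Rightarrow>\<^sub>0 'k) set))" (is "?N \<longleftrightarrow> ?W")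
proof
  assume ?N
  show ?W
  proof (intro allI impI)
    fix w assume w: "set (letters w) \<subseteq> {..<d} \<and> length (letters w) = c"
    let ?xs = "map (\<lambda>i. Poly_Mapping.single (Word [i]) (1::'k)) (letters w)"
    have xs: "?xs \<noteq> []" "set ?xs \<subseteq> free_algebra d"
      using w assms(2) by (auto intro!: single_in_free_algebra simp: free_semigroup_def)
    have "N_prod n d (map (\<lambda>x. power_rel n d `` {x}) ?xs) = N_zero n d"
    proof (rule \<open>?N\<close>[rule_format])
      show "length (map (\<lambda>x. power_rel n d `` {x}) ?xs) = c \<and>
          set (map (\<lambda>x. power_rel n d `` {x}) ?xs) \<subseteq> N_carrier n d"
        using w xs(2) by (auto simp: N_carrier_def intro!: quotientI)
    qed
    then have "prod_list ?xs \<in> power_ideal n d"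
      unfolding N_prod_classes[OF assms(1) xs]
        power_rel_class_eq_N_zero_iff[OF assms(1) prod_list_in_free_algebra[OF xs]] .
    then show "Poly_Mapping.single w 1 \<in> (power_ideal n d :: (word \<Rightarrow>\<^sub>0 'k) set)"
      using single_Word_eq_prod_list[of "letters w", where ?'k = 'k] by simp
  qed
next
  assume ?W
  show ?N
  proof (intro allI impI)
    fix as assume as: "length as = c \<and> set as \<subseteq> (N_carrier n d :: (word \<Rightarrow>\<^sub>0 'k) set set)"
    have "\<forall>X\<in>set as. \<exists>x\<in>free_algebra d. X = power_rel n d `` {x}"
      using as unfolding N_carrier_def by (meson quotientE subsetD)
    then obtain f where f: "\<And>X. X \<in> set as \<Longrightarrow> f X \<in> free_algebra d \<and> X = power_rel n d `` {f X}"
      by metis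
    define xs where "xs = map f as"
    have xs: "xs \<noteq> []" "set xs \<subseteq> free_algebra d" "as = map (\<lambda>x. power_rel n d `` {x}) xs" "length xs = c"
      using as assms(2) f by (auto simp: xs_def intro!: map_idI[symmetric])
    have "Poly_Mapping.single w 1 \<in> (power_ideal n d :: (word \<Rightarrow>\<^sub>0 'k) set)"
      if "w \<in> Poly_Mapping.keys (prod_list xs)" for w
    proof -
      have w: "set (letters w) \<subseteq> {..<d}" "c \<le> length (letters w)"
        using keys_prod_list_free_algebra[OF xs(2)] that xs(4) by auto
      let ?u = "take c (letters w)" and ?v = "drop c (letters w)"
      have "set ?u \<subseteq> {..<d}" "set ?v \<subseteq> {..<d}"
        using w(1) set_take_subset[of c "letters w"] set_drop_subset[of c "letters w"] by blast+
      then have "Poly_Mapping.single (Word ?u) 1 * Poly_Mapping.single (Word ?v) 1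
          \<in> (power_ideal n d :: (word \<Rightarrow>\<^sub>0 'k) set)"
        using \<open>?W\<close> w(2) by (intro word_mult_power_ideal[OF assms(1)]) simp_all
      then show ?thesis by (simp flip: single_Word_append)
    qed
    then have "(\<Sum>w\<in>Poly_Mapping.keys (prod_list xs). Poly_Mapping.single 0 (Poly_Mapping.lookup (prod_list xs) w) *
        Poly_Mapping.single w 1) \<in> (power_ideal n d :: (word \<Rightarrow>\<^sub>0 'k) set)"
      by (intro word_algebra.subspace_sum word_algebra.subspace_scale subspace_power_ideal[OF assms(1)])
    then have "prod_list xs \<in> power_ideal n d"
      by (simp add: mult_single poly_mapping_sum_single)
    then show "N_prod n d as = N_zero n d"
      unfolding xs(3) N_prod_classes[OF assms(1) xs(1,2)]
        power_rel_class_eq_N_zero_iff[OF assms(1) prod_list_in_free_algebra[OF xs(1,2)]] .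
  qed
qed

lemma nilpotency_degree_le:
  assumes "0 < n"
    and "\<And>x. Poly_Mapping.single x 1 \<in> (power_ideal n d :: (word \<Rightarrow>\<^sub>0 'f::field) set) \<Longrightarrow>
      Poly_Mapping.single x 1 \<in> (power_ideal n d :: (word \<Rightarrow>\<^sub>0 'l::field) set)"
  shows "nilpotency_degree TYPE('l) n d \<le> nilpotency_degree TYPE('f) n d"
proof -
  define P where "P X c \<longleftrightarrow> 0 < c \<and> (\<forall>w. set (letters w) \<subseteq> {..<d} \<and> length (letters w) = c \<longrightarrow> w \<in> X)"
    for X c
  let ?F = "{x. Poly_Mapping.single x 1 \<in> (power_ideal n d :: (word \<Rightarrow>\<^sub>0 'f) set)}"
  let ?L = "{x. Poly_Mapping.single x 1 \<in> (power_ideal n d :: (word \<Rightarrow>\<^sub>0 'l) set)}"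
  have deg: "nilpotency_degree TYPE('k) n d =
      (LEAST c. P {x. Poly_Mapping.single x 1 \<in> (power_ideal n d :: (word \<Rightarrow>\<^sub>0 'k::field) set)} c)"
    unfolding nilpotency_degree_def P_def mem_Collect_eq
    by (simp only: nilpotent_iff_long_words_in_power_ideal[OF assms(1)] cong: conj_cong)
  \<comment> \<open>Existence of some such length is what lets \<open>LeastI\<close> give the
    property for the minimum.\<close>
  obtain c where "P ?F c"
    unfolding P_def mem_Collect_eq
    by (rule single_in_power_ideal_if_long[OF assms(1), of d, where ?'k = 'f]) blast
  then have "P ?F (nilpotency_degree TYPE('f) n d)"
    unfolding deg by (rule LeastI)
  then have "P ?L (nilpotency_degree TYPE('f) n d)"
    using assms(2) unfolding P_def by blast
  then have "(LEAST c. P ?L c) \<le> nilpotency_degree TYPE('f) n d" by (rule Least_le)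
  then show ?thesis by (simp only: flip: deg)
qed

subsection \<open>Monomial functions over fields of equal characteristic\<close>

text \<open>Multiplication by a nonzero \<open>x\<close> permutes the nonzero elements; comparing
  their products yields \<open>x ^ (CARD('a) - 1) = 1\<close>.\<close>

lemma power_card_eq_self:
  fixes x :: "'a::field"
  assumes "finite (UNIV :: 'a set)"
  shows "x ^ CARD('a) = x"
proof (cases "x = 0")
  case True
  then show ?thesis using assms by (simp add: card_gt_0_iff)
next
  case False
  have "bij_betw ((*) x) (- {0}) (- {0})"
    by (rule bij_betwI[where g = "(*) (inverse x)"]) (use False in auto)
  then have "(\<Prod>y\<in>- {0}. x * y) = \<Prod>(- {0})" by (rule prod.reindex_bij_betw)
  then have "x ^ card (- {0::'a}) * \<Prod>(- {0}) = \<Prod>(- {0})" by (simp add: prod.distrib)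
  moreover have "\<Prod>(- {0::'a}) \<noteq> 0" using assms by (auto simp: prod_zero_iff finite_subset)
  ultimately have "x ^ card (- {0::'a}) = 1" by simp
  moreover have "CARD('a) = Suc (card (- {0::'a}))"
    using assms by (simp add: Compl_eq_Diff_UNIV card_Diff_singleton card_gt_0_iff)
  ultimately show ?thesis by simp
qed

lemma card_le_if_roots_of_unity:
  fixes A :: "'a::field set"
  assumes "0 < k" and "\<And>s. s \<in> A \<Longrightarrow> s ^ k = 1"
  shows "card A \<le> k"
proof -
  define q :: "'a poly" where "q = monom 1 k - 1"
  have "coeff q k = 1" using assms(1) by (simp add: q_def)
  then have q: "q \<noteq> 0" by auto
  have "A \<subseteq> {s. poly q s = 0}" using assms(2) by (auto simp: q_def poly_monom)
  then have "card A \<le> card {s. poly q s = 0}" by (intro card_mono poly_roots_finite[OF q])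
  also have "\<dots> \<le> degree q" by (rule card_poly_roots_bound[OF q])
  also have "\<dots> \<le> k" unfolding q_def by (intro degree_diff_le) (simp_all add: degree_monom_le)
  finally show ?thesis .
qed

lemma power_diff_eq_1:
  fixes s :: "'a::field"
  assumes "s \<noteq> 0" and "e \<le> e'" and "s ^ e = s ^ e'"
  shows "s ^ (e' - e) = 1"
  using assms power_diff[of s e e'] by simp

text \<open>Otherwise the remainder \<open>r\<close> of \<open>k\<close> modulo
  \<open>CARD('a) - 1\<close> is a positive exponent for which \<open>X ^ r - 1\<close> has more
  roots than its degree.\<close>

lemma card_minus_1_dvd_if_power_eq_1:
  assumes "finite (UNIV :: 'a::field set)" and "\<And>s::'a. s \<noteq> 0 \<Longrightarrow> s ^ k = 1"
  shows "(CARD('a) - 1) dvd k"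
proof (rule ccontr)
  let ?m = "CARD('a) - 1"
  let ?r = "k mod ?m"
  assume "\<not> ?m dvd k"
  then have r: "0 < ?r" by (simp add: mod_greater_zero_iff_not_dvd)
  have "card {0, 1::'a} \<le> CARD('a)" by (intro card_mono assms(1)) simp
  then have m: "0 < ?m" by simp
  have "s ^ ?r = 1" if "s \<in> - {0}" for s :: 'a
  proof -
    have "s ^ CARD('a) = s ^ 1" using power_card_eq_self[OF assms(1), of s] by simp
    then have "s ^ ?m = 1" using that m by (intro power_diff_eq_1) auto
    then have "s ^ (?m * (k div ?m) + ?r) = s ^ ?r"
      by (simp only: power_add power_mult power_one mult_1_left)
    then show ?thesis using assms(2)[of s] that by simp
  qed
  then have "card (- {0::'a}) \<le> ?r" by (rule card_le_if_roots_of_unity[OF r])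
  moreover have "card (- {0::'a}) = ?m" using assms(1) by (simp add: Compl_eq_Diff_UNIV card_Diff_singleton)
  ultimately show False using m by (metis leD mod_less_divisor)
qed

text \<open>Equal power functions on \<open>'l\<close> have exponents that differ by a multiple of
  \<open>CARD('l) - 1\<close>. Since \<open>CARD('l)\<close> is a power of \<open>CARD('f)\<close>,
  iterating \<open>s ^ CARD('f) = s\<close> shows that they agree on \<open>'f\<close> as
  well.\<close>

lemma monomial_eq_transfer_subfield:
  assumes "finite (UNIV :: 'f::field set)" and "finite (UNIV :: 'l::field set)"
    and "CARD('l) = CARD('f) ^ m" and "(monomial ws :: ('a \<Rightarrow> 'l) \<Rightarrow> 'l) = monomial ws'"
  shows "(monomial ws :: ('a \<Rightarrow> 'f) \<Rightarrow> 'f) = monomial ws'"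
proof -
  have "s ^ e = s ^ e'" if "\<forall>s::'l. s ^ e = s ^ e'" for s :: 'f and e e'
    using that
  proof (induction e e' rule: linorder_wlog)
    case (le e e')
    show ?case
    proof (cases "s = 0")
      case True
      have "(e = 0) = (e' = 0)" using le(2)[rule_format, of 0] by (auto simp: power_0_left split: if_splits)
      then show ?thesis using True by (simp add: power_0_left)
    next
      case False
      have "(CARD('l) - 1) dvd (e' - e)"
        by (rule card_minus_1_dvd_if_power_eq_1[OF assms(2)], rule power_diff_eq_1) (use le in auto)
      then obtain k where k: "e' - e = (CARD('l) - 1) * k" by (elim dvdE)
      have "s ^ (CARD('f) ^ j) = s" for j
        by (induction j) (simp_all add: power_mult power_card_eq_self[OF assms(1)])
      then have "s ^ CARD('l) = s ^ 1" using assms(3) by simp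
      moreover have "1 \<le> CARD('l)" using assms(2) by (simp add: Suc_leI card_gt_0_iff)
      ultimately have "s ^ (CARD('l) - 1) = 1" using False by (intro power_diff_eq_1) simp_all
      then have "s ^ (e' - e) = 1" unfolding k by (simp add: power_mult)
      then show ?thesis using le(1) by (metis le_add_diff_inverse mult.right_neutral power_add)
    qed
  qed metis
  then show ?thesis using assms(4) unfolding monomial_eq_iff by blast
qed

lemma set_subset_if_count_list_eq_length: "count_list ws w = length ws \<Longrightarrow> set ws \<subseteq> {w}"
proof (induction ws)
  case (Cons v ws)
  then show ?case using count_le_length[of ws w] by (auto split: if_splits)
qed simp

text \<open>If two exponents of a word differ by \<open>k > 0\<close>, all nonzero elements are
  roots of \<open>X ^ k - 1\<close>, so \<open>k\<close> is at least \<open>n - 1\<close>.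
  Evaluation at 0 shows that the smaller exponent is positive, which leaves only 1 and
  \<open>n\<close>. The monomial with exponent \<open>n\<close> is a pure power, so the other one
  contains no further word and cannot have exponent 1.\<close>

lemma mset_eq_if_monomial_eq:
  assumes "2 \<le> n" and "{..<n} \<lesssim> (UNIV :: 'l::field set)"
    and "length ws = n" and "length ws' = n"
    and "(monomial ws :: ('a \<Rightarrow> 'l) \<Rightarrow> 'l) = monomial ws'"
  shows "mset ws = mset ws'"
proof -
  obtain f :: "nat \<Rightarrow> 'l" where f: "inj_on f {..<n}" using assms(2) unfolding lepoll_def by blast
  have "n - 1 \<le> card (f ` {..<n} - {0})"
    using card_image[OF f] diff_card_le_card_Diff[of "{0}" "f ` {..<n}"] by simp
  then have roots: "n - 1 \<le> k" if "0 < k" "\<And>s::'l. s \<noteq> 0 \<Longrightarrow> s ^ k = 1" for k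
    using card_le_if_roots_of_unity[OF that(1), of "f ` {..<n} - {0}"] that(2) by fastforce
  have False if "count_list us w < count_list us' w" "length us = n" "length us' = n"
    "(monomial us :: ('a \<Rightarrow> 'l) \<Rightarrow> 'l) = monomial us'" for us us' :: "'a list" and w
  proof -
    have eq: "s ^ count_list us v = s ^ count_list us' v" for s :: 'l and v
      using that(4) unfolding monomial_eq_iff by blast
    have zero: "count_list us v = 0 \<longleftrightarrow> count_list us' v = 0" for v
      using eq[of 0 v] by (auto simp: power_0_left split: if_splits)
    have "n - 1 \<le> count_list us' w - count_list us w"
      by (rule roots, use that(1) in simp, rule power_diff_eq_1) (use that(1) eq in auto)
    moreover have "count_list us' w \<le> n" "0 < count_list us w"
      using count_le_length[of us' w] zero[of w] that by auto
    ultimately have w: "count_list us' w = n" "count_list us w = 1" using that(1) by auto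
    then have "set us' \<subseteq> {w}" using that(3) by (intro set_subset_if_count_list_eq_length) simp
    then have "set us \<subseteq> {w}" using zero by (metis count_list_0_iff subset_iff)
    then have "count_list us w = length us" by (induction us) auto
    then show False using w that assms(1) by simp
  qed
  from this[of ws _ ws'] this[of ws' _ ws] have "count_list ws w = count_list ws' w" for w
    using assms(3-5) by (metis linorder_neqE_nat)
  then show ?thesis by (intro multiset_eqI) (simp add: count_mset count_list_eq_length_filter)
qed

text \<open>\<open>CARD('l)\<close> is 0 for an infinite field, so the size of \<open>'l\<close> is
  compared with \<open>n\<close> and with \<open>'f\<close> by injections.\<close>

theorem corollary2p9:
  fixes n d p :: nat
  assumes "n \<ge> 2" and "d \<ge> 2"
    and "finite (UNIV :: 'f::field set)"
    and "CHAR('f) = p" and "CHAR('l::field) = p"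
    and "(UNIV :: 'f set) \<prec> (UNIV :: 'l set)"
  shows
    "(\<forall>l t. CARD('f) < n \<and> (UNIV :: 'l set) \<prec> {..<n} \<and>
        CARD('f) = p ^ l \<and> CARD('l) = p ^ t \<and> l dvd t \<longrightarrow>
        nilpotency_degree TYPE('f) n d \<ge> nilpotency_degree TYPE('l) n d) \<and>
     (CARD('f) < n \<and> {..<n} \<lesssim> (UNIV :: 'l set) \<longrightarrow>
        nilpotency_degree TYPE('f) n d \<ge> nilpotency_degree TYPE('l) n d) \<and>
     (CARD('f) \<ge> n \<and> {..<n} \<lesssim> (UNIV :: 'l set) \<longrightarrow>
        nilpotency_degree TYPE('f) n d = nilpotency_degree TYPE('l) n d)"
proof -
  have n: "0 < n" using assms(1) by simp
  have char: "0 < CHAR('f)" "CHAR('l) = CHAR('f)" "0 < CHAR('l)"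
    using finite_imp_CHAR_pos[OF assms(3)] assms(4,5) by simp_all
  \<comment> \<open>This covers the second case and one inequality of the third.\<close>
  have large: "nilpotency_degree TYPE('l) n d \<le> nilpotency_degree TYPE('f) n d"
    if "{..<n} \<lesssim> (UNIV :: 'l set)"
    by (intro nilpotency_degree_le[OF n] single_in_power_ideal_transfer[OF n char(1,2)])
      (auto intro: monomial_eq_if_mset_eq mset_eq_if_monomial_eq[OF assms(1) that])
  \<comment> \<open>For the other inequality of the third case the fields exchange roles;
    \<open>'f\<close> is large enough to separate monomials of degree \<open>n\<close>.\<close>
  have "nilpotency_degree TYPE('f) n d \<le> nilpotency_degree TYPE('l) n d" if "n \<le> CARD('f)"
  proof -
    have "{..<n} \<lesssim> (UNIV :: 'f set)" using that assms(3) by (simp add: lepoll_iff_card_le)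
    then show ?thesis
      by (intro nilpotency_degree_le[OF n] single_in_power_ideal_transfer[OF n char(3) char(2)[symmetric]])
        (auto intro: monomial_eq_if_mset_eq mset_eq_if_monomial_eq[OF assms(1)])
  qed
  moreover have "nilpotency_degree TYPE('l) n d \<le> nilpotency_degree TYPE('f) n d"
    if "(UNIV :: 'l set) \<prec> {..<n}" "CARD('f) = p ^ l" "CARD('l) = p ^ t" "l dvd t" for l t
  proof -
    have "finite (UNIV :: 'l set)" using that(1) by (simp add: lesspoll_iff_finite_card)
    moreover have "CARD('l) = CARD('f) ^ (t div l)" using that by (simp flip: power_mult)
    ultimately show ?thesis
      by (intro nilpotency_degree_le[OF n] single_in_power_ideal_transfer[OF n char(1,2)])
        (auto intro: monomial_eq_transfer_subfield[OF assms(3)])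
  qed
  ultimately show ?thesis using large by (auto intro: order.antisym)
qed

end
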